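(* Let $Y$ be the periodic $q$-cubical lattice with side lengths $\vec n=(n_1,\dots,n_q)$ (all $n_i\ge2$), $|\vec n|=\prod_in_i$, let $1\le d\le q$, and let $\hat V=\{\mathbf z=(z_1,\dots,z_q)\in\mathbb C^q: z_i^{n_i}=1\ \forall i\}$. Then \begin{align*} \zeta_{Y^{(d)}}(u)^{-1}&=(1-u)^{\kappa_d|\vec n|}(1+\beta_du)^{\gamma_d|\vec n|}\prod_{\mathbf z\in\hat V}\det\Big((1+\alpha_du)(1+\beta_du)I_{K_{d-2}}-uA^{\mathrm{up}}_{d-1}(\mathbf z)\Big)\\ &=(1-u)^{\kappa_d|\vec n|}(1+\alpha_du)^{-\gamma_d|\vec n|}\prod_{\mathbf z\in\hat V}\det\Big((1+\alpha_du)(1+\beta_du)I_{K_{d-1}}-uA^{\mathrm{down}}_{d}(\mathbf z)\Big), \end{align*} where $\alpha_d=2q-2d+1$, $\beta_d=2d-1$, $\gamma_d=\binom qd-\binom q{d-1}$, $\kappa_d=(q-d)\binom q{d-1}+(d-1)\binom qd$, and $I_{K_k}$ is the identity matrix indexed by $K_k$.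
   Context: Let $K$ be the complete simplicial complex on $\{1,\dots,q\}$ (all subsets including $\emptyset$), $K_k$ the set of subsets of cardinality $k+1$. For each $i$ let $\mathcal I_i=\{[0,1],\dots,[n_i-1,0]\}$ (unit intervals in $\mathbb R/n_i\mathbb Z$) and $\mathcal P_i=\{[0,0],\dots,[n_i-1,n_i-1]\}$. For $\sigma\in K$, $Y_\sigma=\{I_1\times\cdots\times I_q:I_i\in\mathcal I_i\text{ if }i\in\sigma,\ I_i\in\mathcal P_i\text{ otherwise}\}$; $Y_k=\bigsqcup_{\sigma\in K_{k-1}}Y_\sigma$ is the set of $k$-cubes, $Y^{(d)}=\bigsqcup_{k=0}^dY_k$, $Y=Y^{(q)}$. A closed path in $Y^{(d)}$ is a cyclic sequence $(\tau_0,\sigma_0,\dots,\tau_{m-1},\sigma_{m-1})$ of $(d-1)$-cubes $\tau_i$ and $d$-cubes $\sigma_i$ with $\tau_i\neq\tau_{i+1}$ and $\tau_{i+1}\subset\sigma_i\cap\sigma_{i+1}$ for all $i\in\mathbb Z/m\mathbb Z$ (length $m$); a closed geodesic if also $\sigma_i\ne\sigma_{i+1}$ for all $i$; prime if not an $r$-fold repetition of a closed geodesic with $r\ge2$; a prime cycle is an equivalence class of prime closed geodesics under cyclic shifts, of length $|\mathfrak p|$. $\zeta_{Y^{(d)}}(u)=\prod_{\mathfrak p}(1-u^{|\mathfrak p|})^{-1}$ over prime cycles, for $|u|$ small. Writing $z_{\{i\}}=z_i$, the twisted adjacency matrices are: $A^{\mathrm{up}}_{d-1}(\mathbf z)$,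 indexed by $K_{d-2}\times K_{d-2}$, with $(\sigma,\sigma)$ entry $\sum_{\eta\in K_{d-1},\eta\supset\sigma}(1+z^{-1}_{\eta\setminus\sigma})(1+z_{\eta\setminus\sigma})$, $(\sigma,\sigma')$ entry $(1+z^{-1}_{\sigma'\setminus\sigma})(1+z_{\sigma\setminus\sigma'})$ if $|\sigma\setminus\sigma'|=1$, and $0$ if $|\sigma\setminus\sigma'|\ge2$; $A^{\mathrm{down}}_d(\mathbf z)$, indexed by $K_{d-1}\times K_{d-1}$, with $(\sigma,\sigma)$ entry $\sum_{\tau\in K_{d-2},\tau\subset\sigma}(1+z_{\sigma\setminus\tau})(1+z^{-1}_{\sigma\setminus\tau})$, $(\sigma,\sigma')$ entry $(1+z_{\sigma\setminus\sigma'})(1+z^{-1}_{\sigma'\setminus\sigma})$ if $|\sigma\setminus\sigma'|=1$, and $0$ if $|\sigma\setminus\sigma'|\ge2$. *)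

theory Defs
  imports "HOL-Analysis.Analysis" "HOL-Library.Real_Mod"
begin

section \<open>The periodic cubical lattice\<close>

text \<open>
  Simplices of the complete complex on \<open>{1..q}\<close>, by dimension. The dimension is an integer so that
  the empty simplex is the unique one of dimension \<open>-1\<close>.
\<close>

definition simplices :: "nat \<Rightarrow> int \<Rightarrow> nat set set" where
  "simplices q k = {\<sigma>. \<sigma> \<subseteq> {1..q} \<and> int (card \<sigma>) = k + 1}"

text \<open>
  The circle \<open>\<real>/m\<int>\<close> is represented by \<open>{0..<m}\<close>, with projection \<open>\<lambda>x. x rmod m\<close>; so \<open>unit_arcs m\<close>
  consists of the arcs \<open>[0,1], \<dots>, [m-1,0]\<close>.
\<close>

definition unit_arcs :: "nat \<Rightarrow> real set set" where
  "unit_arcs m = (\<lambda>j. (\<lambda>x. x rmod real m) ` {real j..real j + 1}) ` {..<m}"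

definition unit_points :: "nat \<Rightarrow> real set set" where
  "unit_points m = (\<lambda>j. {real j}) ` {..<m}"

text \<open>
  Cubes are subsets of the torus \<open>\<Prod>\<^sub>i \<real>/n\<^sub>i\<int>\<close>, whose points are extensional functions on \<open>{1..q}\<close>.
\<close>

definition cubes_along :: "nat \<Rightarrow> (nat \<Rightarrow> nat) \<Rightarrow> nat set \<Rightarrow> (nat \<Rightarrow> real) set set" where
  "cubes_along q n \<sigma> =
     {PiE {1..q} I | I. \<forall>i\<in>{1..q}. I i \<in> (if i \<in> \<sigma> then unit_arcs (n i) else unit_points (n i))}"

definition cubes :: "nat \<Rightarrow> (nat \<Rightarrow> nat) \<Rightarrow> nat \<Rightarrow> (nat \<Rightarrow> real) set set" where
  "cubes q n k = (\<Union>\<sigma>\<in>simplices q (int k - 1). cubes_along q n \<sigma>)"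

section \<open>Closed geodesics and the zeta function\<close>

text \<open>
  The cyclic sequence \<open>(\<tau>\<^sub>0, \<sigma>\<^sub>0, \<dots>, \<tau>\<^sub>m\<^sub>-\<^sub>1, \<sigma>\<^sub>m\<^sub>-\<^sub>1)\<close> is the list of the \<open>m\<close> pairs \<open>(\<tau>\<^sub>i, \<sigma>\<^sub>i)\<close>.
\<close>

type_synonym cube_path = "((nat \<Rightarrow> real) set \<times> (nat \<Rightarrow> real) set) list"

definition closed_path :: "nat \<Rightarrow> (nat \<Rightarrow> nat) \<Rightarrow> nat \<Rightarrow> cube_path \<Rightarrow> bool" where
  "closed_path q n d g \<longleftrightarrow> g \<noteq> [] \<and>
     (\<forall>i<length g. let (\<tau>, \<sigma>) = g ! i; (\<tau>', \<sigma>') = g ! (Suc i mod length g) in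
        \<tau> \<in> cubes q n (d - 1) \<and> \<sigma> \<in> cubes q n d \<and> \<tau> \<noteq> \<tau>' \<and> \<tau>' \<subseteq> \<sigma> \<inter> \<sigma>')"

definition closed_geodesic :: "nat \<Rightarrow> (nat \<Rightarrow> nat) \<Rightarrow> nat \<Rightarrow> cube_path \<Rightarrow> bool" where
  "closed_geodesic q n d g \<longleftrightarrow> closed_path q n d g \<and>
     (\<forall>i<length g. snd (g ! i) \<noteq> snd (g ! (Suc i mod length g)))"

definition prime_geodesic :: "nat \<Rightarrow> (nat \<Rightarrow> nat) \<Rightarrow> nat \<Rightarrow> cube_path \<Rightarrow> bool" where
  "prime_geodesic q n d g \<longleftrightarrow> closed_geodesic q n d g \<and>
     \<not> (\<exists>h r. closed_geodesic q n d h \<and> r \<ge> 2 \<and> g = concat (replicate r h))"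

definition prime_cycles :: "nat \<Rightarrow> (nat \<Rightarrow> nat) \<Rightarrow> nat \<Rightarrow> cube_path set set" where
  "prime_cycles q n d = Collect (prime_geodesic q n d) // {(g, h). \<exists>k. h = rotate k g}"

definition cycle_length :: "cube_path set \<Rightarrow> nat" where
  "cycle_length \<pp> = the_elem (length ` \<pp>)"

definition zeta_partial :: "complex \<Rightarrow> cube_path set set \<Rightarrow> complex" where
  "zeta_partial u F = (\<Prod>\<pp>\<in>F. inverse (1 - u ^ cycle_length \<pp>))"

text \<open>
  The Euler product is the unordered product over the set of prime cycles, that is, the limit of its
  finite partial products. As usual for infinite products, convergence includes that the limit is
  nonzero.
\<close>

definition zeta_converges :: "nat \<Rightarrow> (nat \<Rightarrow> nat) \<Rightarrow> nat \<Rightarrow> complex \<Rightarrow> bool" where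
  "zeta_converges q n d u \<longleftrightarrow>
     (\<exists>L. L \<noteq> 0 \<and> (zeta_partial u \<longlongrightarrow> L) (finite_subsets_at_top (prime_cycles q n d)))"

definition zeta :: "nat \<Rightarrow> (nat \<Rightarrow> nat) \<Rightarrow> nat \<Rightarrow> complex \<Rightarrow> complex" where
  "zeta q n d u = Lim (finite_subsets_at_top (prime_cycles q n d)) (zeta_partial u)"

section \<open>Twisted adjacency matrices\<close>

text \<open>
  Matrices indexed by a finite set \<open>S\<close> are binary functions, considered on \<open>S \<times> S\<close> only. The
  determinant is given by the Leibniz formula, as in the library.
\<close>

definition det_on :: "'i set \<Rightarrow> ('i \<Rightarrow> 'i \<Rightarrow> 'a::comm_ring_1) \<Rightarrow> 'a" where
  "det_on S A = (\<Sum>p | p permutes S. of_int (sign p) * (\<Prod>i\<in>S. A i (p i)))"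

lemma det_on_UNIV: "det_on UNIV (\<lambda>i j. A $ i $ j) = det A"
  by (simp add: det_on_def det_def)

definition id_mat :: "'i \<Rightarrow> 'i \<Rightarrow> complex" where
  "id_mat \<sigma> \<sigma>' = (if \<sigma> = \<sigma>' then 1 else 0)"

definition torus_characters :: "nat \<Rightarrow> (nat \<Rightarrow> nat) \<Rightarrow> (nat \<Rightarrow> complex) set" where
  "torus_characters q n = (\<Pi>\<^sub>E i\<in>{1..q}. {w. w ^ n i = 1})"

definition coord :: "(nat \<Rightarrow> complex) \<Rightarrow> nat set \<Rightarrow> complex" where
  "coord z \<rho> = z (the_elem \<rho>)"

definition A_up :: "nat \<Rightarrow> nat \<Rightarrow> (nat \<Rightarrow> complex) \<Rightarrow> nat set \<Rightarrow> nat set \<Rightarrow> complex" where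
  \<comment> \<open>This is \<open>A\<^sup>u\<^sup>p\<^sub>d\<^sub>-\<^sub>1(z)\<close>: the argument \<open>d\<close> is the dimension of the cubes above.\<close>
  "A_up q d z \<sigma> \<sigma>' =
     (if \<sigma> = \<sigma>' then
        (\<Sum>\<eta> | \<eta> \<in> simplices q (int d - 1) \<and> \<sigma> \<subseteq> \<eta>.
           (1 + inverse (coord z (\<eta> - \<sigma>))) * (1 + coord z (\<eta> - \<sigma>)))
      else if card (\<sigma> - \<sigma>') = 1 then
        (1 + inverse (coord z (\<sigma>' - \<sigma>))) * (1 + coord z (\<sigma> - \<sigma>'))
      else 0)"

definition A_down :: "nat \<Rightarrow> nat \<Rightarrow> (nat \<Rightarrow> complex) \<Rightarrow> nat set \<Rightarrow> nat set \<Rightarrow> complex" where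
  "A_down q d z \<sigma> \<sigma>' =
     (if \<sigma> = \<sigma>' then
        (\<Sum>\<tau> | \<tau> \<in> simplices q (int d - 2) \<and> \<tau> \<subseteq> \<sigma>.
           (1 + coord z (\<sigma> - \<tau>)) * (1 + inverse (coord z (\<sigma> - \<tau>))))
      else if card (\<sigma> - \<sigma>') = 1 then
        (1 + coord z (\<sigma> - \<sigma>')) * (1 + inverse (coord z (\<sigma>' - \<sigma>)))
      else 0)"

section \<open>Numerical parameters\<close>

definition torus_size :: "nat \<Rightarrow> (nat \<Rightarrow> nat) \<Rightarrow> int" where
  "torus_size q n = (\<Prod>i=1..q. int (n i))"

definition alpha :: "nat \<Rightarrow> nat \<Rightarrow> int" where
  "alpha q d = 2 * int q - 2 * int d + 1"

definition beta :: "nat \<Rightarrow> int" where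
  "beta d = 2 * int d - 1"

definition gamma :: "nat \<Rightarrow> nat \<Rightarrow> int" where
  "gamma q d = int (q choose d) - int (q choose (d - 1))"

definition kappa :: "nat \<Rightarrow> nat \<Rightarrow> int" where
  "kappa q d = (int q - int d) * int (q choose (d - 1)) + (int d - 1) * int (q choose d)"

end

theory Submission
  imports
    Defs
    "Jordan_Normal_Form.Char_Poly"
    "Jordan_Normal_Form.Schur_Decomposition"
begin

text \<open>
  In the bipartite incidence graph between \<open>(d-1)\<close>-cubes and \<open>d\<close>-cubes, a closed geodesic is a closed word
  of flags \<open>(\<tau>, \<sigma>)\<close>, \<open>\<tau> \<subset> \<sigma>\<close>, for the relation \<open>(\<tau>, \<sigma>) \<rightarrow> (\<tau>', \<sigma>')\<close> given by \<open>\<tau>' \<subset> \<sigma>\<close>, \<open>\<tau> \<noteq> \<tau>'\<close>,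
  \<open>\<sigma> \<noteq> \<sigma>'\<close>. If \<open>T\<close> is its transition matrix, the logarithm of the Euler product is
  \<open>\<Sum>\<^sub>m tr(T\<^sup>m) u\<^sup>m / m\<close>, so that \<open>\<zeta>(u)\<^sup>-\<^sup>1 = det(1 - uT)\<close>. As the graph is biregular, with degrees \<open>\<alpha>\<^sub>d + 1\<close>
  and \<open>\<beta>\<^sub>d + 1\<close>, factoring \<open>1 - uT\<close> through the blocks of flags sharing \<open>\<sigma>\<close> and applying Sylvester's
  identity leaves \<open>det((1 + \<alpha>\<^sub>d u)(1 + \<beta>\<^sub>d u) - u B B\<^sup>t)\<close>, where \<open>B\<close> is the incidence matrix. The translations
  of the torus act on everything, and their characters split \<open>B B\<^sup>t\<close> into the blocks \<open>A\<^sup>u\<^sup>p(z) = B(z) C(z)\<close>;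
  one more use of Sylvester's identity turns these into \<open>A\<^sup>d\<^sup>o\<^sup>w\<^sup>n(z) = C(z) B(z)\<close>.
\<close>

section \<open>Determinants over finite index sets\<close>

text \<open>The matrix \<open>T\<close> becomes tractable by inclusion-exclusion. For two flags,
  \<open>v = v'\<close> or \<open>w = w'\<close> already forces \<open>v'\<close> to lie in
  \<open>w\<close>, so the indicator of a step is
  \<open>[v' in w] - [v = v'] - [w = w'] + [both equal]\<close>. The last two terms are confined to
  flags sharing \<open>w\<close>; the first two see the target flag only through \<open>v'\<close>,
  so Sylvester's identity reduces them to a matrix indexed by the lower cubes.

  The factorisation divides by \<open>1 - u\<close> and \<open>1 + \<beta> u\<close>; the splitting
  by characters and the second use of Sylvester's identity divide by
  \<open>(1 + \<alpha> u) (1 + \<beta> u)\<close>. All are nonzero near \<open>u = 0\<close>.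

  The trace formula rearranges one absolutely convergent sum, of \<open>u^m / m\<close> over closed
  words of length \<open>m\<close>, in two ways: by length, which gives traces, and by primitive
  root, which gives the Euler product. The latter works because a prime rotation class of length
  \<open>l\<close> has exactly \<open>l\<close> members, cancelling the \<open>l\<close> in
  \<open>1 / (k l)\<close>.

  Sides of length at least 2 keep opposite faces of a cube distinct, which fixes the
  degrees.\<close>

lemma det_on_cong:
  assumes "\<And>i j. i \<in> S \<Longrightarrow> j \<in> S \<Longrightarrow> A i j = B i j"
  shows "det_on S A = det_on S B"
  unfolding det_on_def
  by (intro sum.cong refl arg_cong2[where f = "(*)"] prod.cong assms) (auto simp: permutes_in_image)

text \<open>Conjugation by \<open>f\<close> matches the permutations of \<open>S\<close> with those
  of \<open>T\<close> and preserves signs, so the two Leibniz sums agree term by term.\<close>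

lemma det_on_reindex:
  assumes "bij_betw f S T" "finite S"
  shows "det_on T A = det_on S (\<lambda>i j. A (f i) (f j))"
proof -
  have inj: "inj_on f S" and T: "T = f ` S"
    using assms(1) by (auto simp: bij_betw_def)
  have "bij_betw (map_permutation S f) {p. p permutes S} {p. p permutes T}"
  proof (rule bij_betw_byWitness[where f' = "map_permutation T (inv_into S f)"])
    have b: "bij_betw (inv_into S f) T S"
      using assms(1) by (rule bij_betw_inv_into)
    show "\<forall>p\<in>{p. p permutes S}. map_permutation T (inv_into S f) (map_permutation S f p) = p"
      using inj by (auto intro!: map_permutation_compose_inv[OF assms(1)])
    show "\<forall>p\<in>{p. p permutes T}. map_permutation S f (map_permutation T (inv_into S f) p) = p"
      using assms(1) by (auto intro!: map_permutation_compose_inv[OF b] simp: bij_betw_inv_into_right)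
    show "map_permutation S f ` {p. p permutes S} \<subseteq> {p. p permutes T}"
      using map_permutation_permutes[OF assms(1)] by auto
    show "map_permutation T (inv_into S f) ` {p. p permutes T} \<subseteq> {p. p permutes S}"
      using map_permutation_permutes[OF b] by auto
  qed
  hence "det_on T A = (\<Sum>p | p permutes S. of_int (sign (map_permutation S f p)) *
      (\<Prod>i\<in>T. A i (map_permutation S f p i)))"
    unfolding det_on_def by (subst sum.reindex_bij_betw[symmetric]) auto
  also have "\<dots> = (\<Sum>p | p permutes S. of_int (sign p) * (\<Prod>i\<in>S. A (f i) (f (p i))))"
  proof (intro sum.cong refl, goal_cases)
    case (1 p)
    have "(\<Prod>i\<in>T. A i (map_permutation S f p i)) = (\<Prod>i\<in>S. A (f i) (map_permutation S f p (f i)))"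
      using assms(1) by (rule prod.reindex_bij_betw[symmetric])
    also have "\<dots> = (\<Prod>i\<in>S. A (f i) (f (p i)))"
      by (intro prod.cong refl) (simp add: map_permutation_apply inj)
    finally show ?case
      using 1 by (simp add: sign_map_permutation[OF inj _ assms(2)])
  qed
  finally show ?thesis unfolding det_on_def .
qed

text \<open>Bridge to matrices with numeric indices: \<open>f\<close> and \<open>g\<close> enumerate
  the row and column index sets, so facts about products, block matrices and triangular forms carry
  over to \<open>det_on\<close>.\<close>

definition mat_on :: "(nat \<Rightarrow> 'i) \<Rightarrow> (nat \<Rightarrow> 'j) \<Rightarrow> nat \<Rightarrow> nat \<Rightarrow> ('i \<Rightarrow> 'j \<Rightarrow> 'a) \<Rightarrow> 'a mat" where
  "mat_on f g n m A = Matrix.mat n m (\<lambda>(i, j). A (f i) (g j))"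

lemma mat_on_carrier [simp]: "mat_on f g n m A \<in> carrier_mat n m"
  by (simp add: mat_on_def)

lemma det_on_eq_det:
  assumes "bij_betw f {0..<n} S"
  shows "det_on S A = Determinant.det (mat_on f f n n A)"
proof -
  have "det_on S A = det_on {0..<n} (\<lambda>i j. A (f i) (f j))"
    using assms by (rule det_on_reindex) simp
  also have "\<dots> = Determinant.det (mat_on f f n n A)"
    unfolding det_on_def det_def'[OF mat_on_carrier]
    by (intro sum.cong refl arg_cong2[where f = "(*)"] prod.cong)
       (auto simp: mat_on_def dest: permutes_in_image)
  finally show ?thesis .
qed

lemma mat_on_mult:
  assumes "bij_betw g {0..<m} T"
  shows "mat_on f g n m A * mat_on g h m k B = mat_on f h n k (\<lambda>i j. \<Sum>t\<in>T. A i t * B t j)"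
  by (rule eq_matI)
     (auto simp: mat_on_def scalar_prod_def sum.reindex_bij_betw[OF assms, symmetric])

lemma det_on_mult:
  fixes A :: "'i \<Rightarrow> 'i \<Rightarrow> 'a::idom"
  assumes "finite S"
  shows "det_on S (\<lambda>i j. \<Sum>k\<in>S. A i k * B k j) = det_on S A * det_on S B"
proof -
  obtain f where f: "bij_betw f {0..<card S} S"
    using ex_bij_betw_nat_finite[OF assms] by blast
  show ?thesis
    unfolding det_on_eq_det[OF f] mat_on_mult[OF f, symmetric] by (rule det_mult[OF mat_on_carrier mat_on_carrier])
qed

lemma det_on_Un:
  fixes A :: "'i \<Rightarrow> 'i \<Rightarrow> 'a::idom"
  assumes "finite S" "finite T" "S \<inter> T = {}" and 0: "\<And>i j. i \<in> T \<Longrightarrow> j \<in> S \<Longrightarrow> A i j = 0"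
  shows "det_on (S \<union> T) A = det_on S A * det_on T A"
proof -
  let ?n = "card S" and ?m = "card T"
  obtain f where f: "bij_betw f {0..<?n} S"
    using ex_bij_betw_nat_finite[OF assms(1)] by blast
  obtain g where g: "bij_betw g {0..<?m} T"
    using ex_bij_betw_nat_finite[OF assms(2)] by blast
  \<comment> \<open>The enumeration lists \<open>S\<close> before \<open>T\<close>, so the vanishing
    entries form the lower left block.\<close>
  define h where "h i = (if i < ?n then f i else g (i - ?n))" for i
  have h1: "bij_betw h {0..<?n} S"
    using f by (subst bij_betw_cong[of _ _ f]) (auto simp: h_def)
  have "bij_betw (\<lambda>i. i - ?n) {?n..<?n + ?m} {0..<?m}"
    by (rule bij_betw_byWitness[where f' = "\<lambda>i. i + ?n"]) auto
  from bij_betw_trans[OF this g] have h2: "bij_betw h {?n..<?n + ?m} T"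
    by (subst bij_betw_cong[of _ _ "g \<circ> (\<lambda>i. i - ?n)"]) (auto simp: h_def)
  have h: "bij_betw h {0..<?n + ?m} (S \<union> T)"
    using bij_betw_combine[OF h1 h2 assms(3)] by (simp add: ivl_disj_un)
  have "mat_on h h (?n + ?m) (?n + ?m) A =
      four_block_mat (mat_on f f ?n ?n A) (mat_on f g ?n ?m A) (0\<^sub>m ?m ?n) (mat_on g g ?m ?m A)"
    using bij_betw_apply[OF f] bij_betw_apply[OF g]
    by (intro eq_matI) (auto simp: mat_on_def h_def intro!: 0)
  thus ?thesis
    unfolding det_on_eq_det[OF f] det_on_eq_det[OF g] det_on_eq_det[OF h]
    by (simp add: det_four_block_mat_lower_left_zero[OF mat_on_carrier mat_on_carrier refl mat_on_carrier])
qed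

lemma det_on_diag:
  assumes "finite S"
  shows "det_on S (\<lambda>i j. if i = j then c i else 0) = (\<Prod>i\<in>S. c i :: 'a::idom)"
  using assms
proof (induction S)
  case empty
  show ?case by (simp add: det_on_def)
next
  case (insert x S)
  have "det_on ({x} \<union> S) (\<lambda>i j. if i = j then c i else 0) =
      det_on {x} (\<lambda>i j. if i = j then c i else 0) * det_on S (\<lambda>i j. if i = j then c i else 0)"
    using insert.hyps by (intro det_on_Un) auto
  thus ?case using insert by (simp add: det_on_def)
qed

lemma det_on_scale:
  "det_on S (\<lambda>i j. c * A i j) = c ^ card S * det_on S A"
  by (simp add: det_on_def prod.distrib sum_distrib_left mult_ac)

text \<open>The block matrix with rows \<open>(1, A)\<close> and \<open>(B, 1)\<close> is multiplied
  by the unipotent matrix with rows \<open>(1, 0)\<close> and \<open>(-B, 1)\<close>. On the right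
  this leaves \<open>1 - A B\<close> as the only nontrivial diagonal block, on the left
  \<open>1 - B A\<close>; both have the determinant of the original matrix.\<close>

lemma det_on_sylvester:
  fixes A :: "'i \<Rightarrow> 'j \<Rightarrow> 'a::idom"
  assumes "finite S" "finite T"
  shows "det_on S (\<lambda>i j. (if i = j then 1 else 0) - (\<Sum>t\<in>T. A i t * B t j)) =
         det_on T (\<lambda>i j. (if i = j then 1 else 0) - (\<Sum>s\<in>S. B i s * A s j))"
proof -
  let ?n = "card S" and ?m = "card T"
  obtain f where f: "bij_betw f {0..<?n} S"
    using ex_bij_betw_nat_finite[OF assms(1)] by blast
  obtain g where g: "bij_betw g {0..<?m} T"
    using ex_bij_betw_nat_finite[OF assms(2)] by blast
  define A' B' where "A' = mat_on f g ?n ?m A" and "B' = mat_on g f ?m ?n B"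
  have c: "A' \<in> carrier_mat ?n ?m" "B' \<in> carrier_mat ?m ?n"
    by (simp_all add: A'_def B'_def)
  note c' = c mult_carrier_mat[OF c] mult_carrier_mat[OF c(2,1)]
  let ?M = "four_block_mat (1\<^sub>m ?n) A' B' (1\<^sub>m ?m)"
  let ?L = "four_block_mat (1\<^sub>m ?n) (0\<^sub>m ?n ?m) (- B') (1\<^sub>m ?m)"
  have L: "Determinant.det ?L = 1"
    using c by (subst det_four_block_mat_upper_right_zero) auto
  have "?M * ?L = four_block_mat (1\<^sub>m ?n - A' * B') A' (0\<^sub>m ?m ?n) (1\<^sub>m ?m)"
    using c by (subst mult_four_block_mat[of _ ?n ?n _ ?m _ ?m _ _ ?n _ ?m])
      (auto intro!: cong_four_block_mat)
  hence "Determinant.det ?M = Determinant.det (1\<^sub>m ?n - A' * B')"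
    using c' L det_mult[of ?M "?n + ?m" ?L]
    by (simp add: det_four_block_mat_lower_left_zero[of _ ?n _ ?m] minus_carrier_mat)
  moreover have "?L * ?M = four_block_mat (1\<^sub>m ?n) A' (0\<^sub>m ?m ?n) (1\<^sub>m ?m - B' * A')"
    using c by (subst mult_four_block_mat[of _ ?n ?n _ ?m _ ?m _ _ ?n _ ?m])
      (auto intro!: cong_four_block_mat)
  hence "Determinant.det ?M = Determinant.det (1\<^sub>m ?m - B' * A')"
    using c' L det_mult[of ?L "?n + ?m" ?M]
    by (simp add: det_four_block_mat_lower_left_zero[of _ ?n _ ?m] minus_carrier_mat)
  moreover have "mat_on f f ?n ?n (\<lambda>i j. (if i = j then 1 else 0) - (\<Sum>t\<in>T. A i t * B t j)) =
      1\<^sub>m ?n - A' * B'"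
    unfolding A'_def B'_def mat_on_mult[OF g] using f
    by (intro eq_matI) (auto simp: mat_on_def bij_betw_def inj_on_eq_iff)
  moreover have "mat_on g g ?m ?m (\<lambda>i j. (if i = j then 1 else 0) - (\<Sum>s\<in>S. B i s * A s j)) =
      1\<^sub>m ?m - B' * A'"
    unfolding A'_def B'_def mat_on_mult[OF f] using g
    by (intro eq_matI) (auto simp: mat_on_def bij_betw_def inj_on_eq_iff)
  ultimately show ?thesis
    unfolding det_on_eq_det[OF f] det_on_eq_det[OF g] by simp
qed

section \<open>Traces of powers\<close>

primrec pow_on :: "'i set \<Rightarrow> ('i \<Rightarrow> 'i \<Rightarrow> 'a::comm_ring_1) \<Rightarrow> nat \<Rightarrow> 'i \<Rightarrow> 'i \<Rightarrow> 'a" where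
  "pow_on S A 0 = (\<lambda>i j. if i = j then 1 else 0)"
| "pow_on S A (Suc m) = (\<lambda>i j. \<Sum>k\<in>S. pow_on S A m i k * A k j)"

lemma mat_on_pow_on:
  assumes "bij_betw f {0..<n} S"
  shows "mat_on f f n n (pow_on S A m) = mat_on f f n n A ^\<^sub>m m"
proof (induction m)
  case 0
  show ?case
    using assms by (intro eq_matI) (auto simp: mat_on_def bij_betw_def inj_on_eq_iff)
next
  case (Suc m)
  thus ?case by (simp add: mat_on_mult[OF assms, symmetric])
qed

lemma sum_diag_mult_commute:
  assumes "A \<in> carrier_mat n m" "B \<in> carrier_mat m n"
  shows "(\<Sum>i<n. (A * B) $$ (i, i)) = (\<Sum>i<m. (B * A) $$ (i, i) :: 'a::comm_ring_1)"
proof -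
  have "(\<Sum>i<n. (A * B) $$ (i, i)) = (\<Sum>i<n. \<Sum>k<m. A $$ (i, k) * B $$ (k, i))"
    using assms by (auto simp: scalar_prod_def lessThan_atLeast0)
  also have "\<dots> = (\<Sum>k<m. \<Sum>i<n. B $$ (k, i) * A $$ (i, k))"
    by (subst sum.swap) (simp add: mult.commute)
  also have "\<dots> = (\<Sum>i<m. (B * A) $$ (i, i))"
    using assms by (auto simp: scalar_prod_def lessThan_atLeast0)
  finally show ?thesis .
qed

text \<open>The zeros below the diagonal belong to the claim because the induction needs them: they
  reduce the sum over \<open>l\<close> to the single term \<open>l = i\<close>.\<close>

lemma upper_triangular_pow:
  fixes B :: "'a::comm_ring_1 mat"
  assumes B: "B \<in> carrier_mat n n" "upper_triangular B" and "i < n" "j \<le> i"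
  shows "(B ^\<^sub>m m) $$ (i, j) = (if i = j then B $$ (i, i) ^ m else 0)"
  using assms(3,4)
proof (induction m arbitrary: i j)
  case 0
  thus ?case using B by auto
next
  case (Suc m)
  have "(B ^\<^sub>m Suc m) $$ (i, j) = (\<Sum>l<n. (B ^\<^sub>m m) $$ (i, l) * B $$ (l, j))"
    using B Suc.prems by (auto simp: scalar_prod_def lessThan_atLeast0 pow_mat_dim)
  also have "\<dots> = (\<Sum>l<n. if l = i then (if i = j then B $$ (i, i) ^ Suc m else 0) else 0)"
  proof (intro sum.cong refl, goal_cases)
    case (1 l)
    show ?case
    proof (cases "l \<le> i")
      case True
      thus ?thesis
        using Suc B 1 by (auto simp: upper_triangularD)
    next
      case False
      hence "B $$ (l, j) = 0"
        using B 1 Suc.prems by (intro upper_triangularD) auto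
      with False show ?thesis by auto
    qed
  qed
  also have "\<dots> = (if i = j then B $$ (i, i) ^ Suc m else 0)"
    using Suc.prems by simp
  finally show ?case .
qed

lemma similar_mat_wit_pow_mat:
  assumes "A \<in> carrier_mat n n" "similar_mat_wit A B P Q"
  shows "A ^\<^sub>m m = P * B ^\<^sub>m m * Q"
proof (induction m)
  note D = similar_mat_witD2[OF assms]
  note [simp] = assoc_mult_mat[of _ n n _ n _ n]
  {
    case 0
    show ?case using D by auto
  next
    case (Suc m)
    have Bm: "B ^\<^sub>m m \<in> carrier_mat n n" using D by simp
    have "A ^\<^sub>m Suc m = (P * B ^\<^sub>m m * Q) * (P * B * Q)"
      using Suc D(3) by simp
    also have "\<dots> = P * B ^\<^sub>m m * (Q * P) * B * Q"
      using D(4-7) Bm by (simp add: mult_carrier_mat[of _ n n _ n])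
    also have "\<dots> = P * B ^\<^sub>m Suc m * Q"
      using D Bm by simp
    finally show ?case .
  }
qed

text \<open>A Schur triangularisation serves both conclusions with the same diagonal entries
  \<open>e\<close>, counted with multiplicity. This common list links \<open>det(1 - uA)\<close> to
  the traces of the powers of \<open>A\<close>.\<close>

lemma exists_eigenvalues_on:
  fixes A :: "'i \<Rightarrow> 'i \<Rightarrow> complex"
  assumes "finite S"
  obtains e :: "nat \<Rightarrow> complex" where
    "\<And>u. det_on S (\<lambda>i j. (if i = j then 1 else 0) - u * A i j) = (\<Prod>k<card S. 1 - u * e k)"
    "\<And>m. (\<Sum>i\<in>S. pow_on S A m i i) = (\<Sum>k<card S. e k ^ m)"
proof -
  define n where "n = card S"
  obtain f where f: "bij_betw f {0..<n} S"
    using ex_bij_betw_nat_finite[OF assms] unfolding n_def by blast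
  define M where "M = mat_on f f n n A"
  have M: "M \<in> carrier_mat n n" by (simp add: M_def)
  obtain as where as: "char_poly M = (\<Prod>a\<leftarrow>as. [:- a, 1:])"
    using char_poly_factorized[OF M] by blast
  obtain B P Q where "schur_decomposition M as = (B, P, Q)"
    by (cases "schur_decomposition M as")
  from schur_decomposition[OF M as this]
  have wit: "similar_mat_wit M B P Q" and ut: "upper_triangular B" by auto
  note D = similar_mat_witD2[OF M wit]
  note [simp] = assoc_mult_mat[of _ n n _ n _ n]
  show ?thesis
  proof (rule that[of "\<lambda>k. B $$ (k, k)"], unfold n_def[symmetric])
    fix u
    have "det_on S (\<lambda>i j. (if i = j then 1 else 0) - u * A i j) = Determinant.det (1\<^sub>m n - u \<cdot>\<^sub>m M)"
      unfolding det_on_eq_det[OF f] M_def using f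
      by (intro arg_cong[where f = Determinant.det] eq_matI)
         (auto simp: mat_on_def bij_betw_def inj_on_eq_iff)
    also have "1\<^sub>m n - u \<cdot>\<^sub>m M = P * (1\<^sub>m n - u \<cdot>\<^sub>m B) * Q"
    proof -
      have uB: "u \<cdot>\<^sub>m B \<in> carrier_mat n n" using D by simp
      have "P * (1\<^sub>m n - u \<cdot>\<^sub>m B) * Q = (P - P * (u \<cdot>\<^sub>m B)) * Q"
        using D(4-7) uB by (subst mult_minus_distrib_mat[of _ n n]) auto
      also have "\<dots> = P * Q - P * (u \<cdot>\<^sub>m B) * Q"
        using D uB by (subst minus_mult_distrib_mat[of _ n n]) auto
      also have "P * (u \<cdot>\<^sub>m B) * Q = u \<cdot>\<^sub>m (P * B * Q)"
        using D by (simp add: mult_smult_distrib[of _ n n _ n] mult_smult_assoc_mat[of _ n n _ n])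
      finally show ?thesis using D by simp
    qed
    also have "Determinant.det \<dots> = Determinant.det (1\<^sub>m n - u \<cdot>\<^sub>m B)"
    proof -
      have 1: "1\<^sub>m n - u \<cdot>\<^sub>m B \<in> carrier_mat n n" using D by (simp add: minus_carrier_mat)
      have "Determinant.det P * Determinant.det Q = 1"
        using D det_mult[of P n Q] by simp
      thus ?thesis
        using D 1 by (simp add: det_mult[of _ n] del: assoc_mult_mat)
    qed
    also have "\<dots> = (\<Prod>k<n. 1 - u * B $$ (k, k))"
    proof (subst det_upper_triangular[of _ n])
      show "upper_triangular (1\<^sub>m n - u \<cdot>\<^sub>m B)"
        using D ut by (auto intro!: upper_triangularI dest: upper_triangularD)
      show "1\<^sub>m n - u \<cdot>\<^sub>m B \<in> carrier_mat n n" using D by (simp add: minus_carrier_mat)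
      show "prod_list (diag_mat (1\<^sub>m n - u \<cdot>\<^sub>m B)) = (\<Prod>k<n. 1 - u * B $$ (k, k))"
        using D by (auto simp: prod_list_diag_prod lessThan_atLeast0 intro!: prod.cong)
    qed
    finally show "det_on S (\<lambda>i j. (if i = j then 1 else 0) - u * A i j) = (\<Prod>k<n. 1 - u * B $$ (k, k))" .
  next
    fix m
    have Bm: "B ^\<^sub>m m \<in> carrier_mat n n" using D by simp
    have "(\<Sum>i\<in>S. pow_on S A m i i) = (\<Sum>k<n. (M ^\<^sub>m m) $$ (k, k))"
      unfolding M_def mat_on_pow_on[OF f, symmetric]
      by (subst sum.reindex_bij_betw[OF f, symmetric]) (auto simp: mat_on_def lessThan_atLeast0)
    also have "\<dots> = (\<Sum>k<n. (P * (B ^\<^sub>m m * Q)) $$ (k, k))"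
      by (simp only: similar_mat_wit_pow_mat[OF M wit] assoc_mult_mat[OF D(6) Bm D(7)])
    also have "\<dots> = (\<Sum>k<n. (B ^\<^sub>m m * Q * P) $$ (k, k))"
      using D Bm by (intro sum_diag_mult_commute) auto
    also have "\<dots> = (\<Sum>k<n. (B ^\<^sub>m m) $$ (k, k))"
      using D Bm by simp
    also have "\<dots> = (\<Sum>k<n. (B $$ (k, k)) ^ m)"
      using D ut by (simp add: upper_triangular_pow)
    finally show "(\<Sum>i\<in>S. pow_on S A m i i) = (\<Sum>k<n. (B $$ (k, k)) ^ m)" .
  qed
qed

section \<open>Closed words of a relation\<close>

definition closed_word :: "'a set \<Rightarrow> ('a \<Rightarrow> 'a \<Rightarrow> bool) \<Rightarrow> 'a list \<Rightarrow> bool" where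
  "closed_word X T g \<longleftrightarrow> g \<noteq> [] \<and> set g \<subseteq> X \<and> (\<forall>i<length g. T (g ! i) (g ! (Suc i mod length g)))"

definition prime_word :: "'a set \<Rightarrow> ('a \<Rightarrow> 'a \<Rightarrow> bool) \<Rightarrow> 'a list \<Rightarrow> bool" where
  "prime_word X T g \<longleftrightarrow> closed_word X T g \<and>
     \<not> (\<exists>h r. closed_word X T h \<and> r \<ge> 2 \<and> g = concat (replicate r h))"

section \<open>Powers, periods and primitive roots of cyclic words\<close>

lemma nth_concat_replicate:
  "i < r * length h \<Longrightarrow> concat (replicate r h) ! i = h ! (i mod length h)"
proof (induction r arbitrary: i)
  case (Suc r)
  show ?case
  proof (cases "i < length h")
    case False
    hence "concat (replicate r h) ! (i - length h) = h ! ((i - length h) mod length h)"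
      using Suc.prems by (intro Suc.IH) auto
    thus ?thesis using False le_mod_geq[of "length h" i] by (simp add: nth_append)
  qed (simp add: nth_append)
qed simp

lemma length_concat_replicate [simp]: "length (concat (replicate r h)) = r * length h"
  by (induction r) auto

lemma concat_replicate_eq_Nil_iff: "concat (replicate r h) = [] \<longleftrightarrow> r = 0 \<or> h = []"
  by (metis length_concat_replicate length_0_conv mult_eq_0_iff)

lemma closed_word_concat_replicate_iff:
  assumes "r > 0"
  shows "closed_word X T (concat (replicate r h)) \<longleftrightarrow> closed_word X T h"
proof (cases "h = []")
  case False
  define m where "m = length h"
  have m: "m > 0" using False by (simp add: m_def)
  have nth: "concat (replicate r h) ! i = h ! (i mod m)" if "i < r * m" for i
    using that nth_concat_replicate by (auto simp: m_def)
  have suc: "Suc i mod (r * m) mod m = Suc (i mod m) mod m" for i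
    by (simp add: mod_mod_cancel mod_Suc_eq)
  have "(\<forall>i<r * m. T (concat (replicate r h) ! i) (concat (replicate r h) ! (Suc i mod (r * m)))) \<longleftrightarrow>
        (\<forall>i<r * m. T (h ! (i mod m)) (h ! (Suc (i mod m) mod m)))"
    using m assms by (intro all_cong) (simp add: nth suc)
  also have "\<dots> \<longleftrightarrow> (\<forall>i<m. T (h ! i) (h ! (Suc i mod m)))"
  proof safe
    fix i assume *: "\<forall>i<r * m. T (h ! (i mod m)) (h ! (Suc (i mod m) mod m))" and i: "i < m"
    have "m \<le> r * m" using assms by simp
    with i have "i < r * m" by linarith
    with * i show "T (h ! i) (h ! (Suc i mod m))" by (metis mod_less)
  qed (use m in auto)
  finally show ?thesis
    using assms False by (auto simp: closed_word_def concat_replicate_eq_Nil_iff m_def)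
qed (simp add: closed_word_def)

text \<open>The shifts that fix \<open>g\<close> include \<open>k\<close> and the length of
  \<open>g\<close>, hence by Bezout their greatest common divisor.\<close>

lemma rotate_eq_self_gcd:
  assumes "rotate k g = g"
  shows "rotate (gcd k (length g)) g = g"
proof (cases "k = 0 \<or> g = []")
  case False
  then obtain x y where "k * x = length g * y + gcd k (length g)"
    using bezout_nat[of k "length g"] by blast
  moreover have "rotate (k * x) g = g"
    using assms by (induction x) (simp_all add: rotate_rotate[symmetric])
  ultimately show ?thesis
    by (metis mod_mult_self4 rotate_conv_mod)
qed auto

text \<open>Invariance under the shift by \<open>e\<close> makes each letter depend only on its
  position modulo \<open>e\<close>; as \<open>e\<close> divides the length, the first
  \<open>e\<close> letters repeat a whole number of times.\<close>

lemma rotate_eq_self_dvd: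
  assumes "rotate e g = g" "e dvd length g" "e > 0"
  shows "g = concat (replicate (length g div e) (take e g))"
proof (cases "g = []")
  case False
  have shift: "g ! ((e * j + i) mod length g) = g ! i" if "i < length g" for i j
  proof (induction j)
    case (Suc j)
    have "g ! ((e * j + i) mod length g) = rotate e g ! ((e * j + i) mod length g)"
      using assms by simp
    also have "\<dots> = g ! ((e + (e * j + i) mod length g) mod length g)"
      using False by (subst nth_rotate) auto
    also have "\<dots> = g ! ((e * Suc j + i) mod length g)"
      by (simp add: mod_add_right_eq add_ac)
    finally show ?case using Suc by simp
  qed (use that in simp)
  have le: "e \<le> length g" using assms False by (simp add: dvd_imp_le)
  show ?thesis
  proof (rule nth_equalityI)
    show "length g = length (concat (replicate (length g div e) (take e g)))"
      using assms le by simp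
    fix i assume i: "i < length g"
    have "i mod e < length g" using assms le by (meson less_le_trans mod_less_divisor)
    hence "g ! ((e * (i div e) + i mod e) mod length g) = g ! (i mod e)"
      by (rule shift)
    hence "g ! i = g ! (i mod e)" using i by simp
    also have "\<dots> = concat (replicate (length g div e) (take e g)) ! i"
      using i le assms by (subst nth_concat_replicate) auto
    finally show "g ! i = concat (replicate (length g div e) (take e g)) ! i" .
  qed
qed simp

lemma rotate_concat_replicate_self:
  "rotate (length h) (concat (replicate r h)) = concat (replicate r h)"
proof (cases r)
  case (Suc r')
  have "h @ concat (replicate r' h) = concat (replicate r' h) @ h"
    by (induction r') auto
  moreover have "rotate (length h) (h @ concat (replicate r' h)) = concat (replicate r' h) @ h"
    by (rule rotate_append)
  ultimately show ?thesis using Suc by simp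
qed simp

text \<open>Aperiodicity of prime words: a smaller period, reduced to a divisor \<open>e\<close> of
  the length, would exhibit \<open>g\<close> as a proper power of its first \<open>e\<close>
  letters.\<close>

lemma prime_word_rotate_eq_self:
  assumes "prime_word X T g" "rotate k g = g"
  shows "length g dvd k"
proof -
  define e where "e = gcd k (length g)"
  have g: "g \<noteq> []" using assms by (auto simp: prime_word_def closed_word_def)
  have e: "e dvd length g" "e > 0" using g by (auto simp: e_def)
  have eq: "g = concat (replicate (length g div e) (take e g))"
    using rotate_eq_self_gcd[OF assms(2)] e unfolding e_def by (intro rotate_eq_self_dvd)
  have pos: "length g div e > 0"
    using g e by (simp add: div_greater_zero_iff dvd_imp_le)
  have "closed_word X T (take e g)"
    using assms(1) eq closed_word_concat_replicate_iff[OF pos, of X T "take e g"]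
    by (auto simp: prime_word_def)
  with assms(1) eq have "\<not> length g div e \<ge> 2" by (auto simp: prime_word_def)
  with pos have "length g div e = 1" by linarith
  with e have "e = length g" by (metis dvd_div_mult_self mult_1)
  thus ?thesis by (metis e_def gcd_dvd1)
qed

text \<open>The length of either root divides every shift fixing the common power. The length of the
  other root is such a shift, so the two lengths divide each other, and both roots are the same
  prefix of the power.\<close>

lemma prime_word_power_unique:
  assumes "prime_word X T g" "prime_word X T h" "r > 0" "s > 0"
    and eq: "concat (replicate r g) = concat (replicate s h)"
  shows "g = h \<and> r = s"
proof -
  define w where "w = concat (replicate r g)"
  have ne: "g \<noteq> []" "h \<noteq> []" using assms(1,2) by (auto simp: prime_word_def closed_word_def)
  have len: "length w = r * length g" "length w = s * length h"
    using eq by (metis w_def length_concat_replicate)+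
  have tk: "take (length g) w = g" "take (length h) w = h"
  proof -
    have "take (length a) (concat (replicate t a)) = a" if "t > 0" for a :: "'a list" and t
      using that by (cases t) simp_all
    thus "take (length g) w = g" "take (length h) w = h"
      using assms(3,4) by (simp add: w_def, simp add: w_def eq)
  qed
  \<comment> \<open>A shift that fixes \<open>w\<close> also fixes its root \<open>a\<close>, since
    indices modulo the length of \<open>w\<close> can be reduced further modulo the length of
    \<open>a\<close>.\<close>
  have *: "length a dvd k"
    if a: "prime_word X T a" and t: "t > 0" and w: "w = concat (replicate t a)"
      and k: "rotate k w = w" for a t k
  proof -
    have ap: "length a > 0" using a by (auto simp: prime_word_def closed_word_def)
    have "rotate k a = a"
    proof (rule nth_equalityI)
      fix i assume "i < length (rotate k a)"
      hence i: "i < length a" by simp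
      have lw: "length w = t * length a" by (simp add: w)
      have "length a \<le> t * length a" using t by simp
      with i have i': "i < t * length a" by linarith
      have "a ! i = w ! i" using i i' by (simp add: w nth_concat_replicate)
      also have "\<dots> = w ! ((k + i) mod length w)"
        using k i' lw by (metis nth_rotate)
      also have "\<dots> = a ! ((k + i) mod length w mod length a)"
        using ap t unfolding lw by (subst w, subst nth_concat_replicate) auto
      also have "\<dots> = rotate k a ! i"
        using i lw by (simp add: nth_rotate mod_mod_cancel)
      finally show "rotate k a ! i = a ! i" by simp
    qed simp
    thus ?thesis using prime_word_rotate_eq_self a by blast
  qed
  have "length g dvd length h"
    using assms(1,3) rotate_concat_replicate_self[of h s] eq w_def by (intro *[of g r]) simp_all
  moreover have "length h dvd length g"
    using assms(2,4) rotate_concat_replicate_self[of g r] eq w_def by (intro *[of h s]) simp_all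
  ultimately have l: "length g = length h" by (rule dvd_antisym)
  hence "g = h" using tk by metis
  thus ?thesis using len ne by simp
qed

text \<open>Extracting roots terminates because an exponent of at least 2 makes the root strictly
  shorter.\<close>

lemma closed_word_prime_power:
  assumes "closed_word X T g"
  shows "\<exists>h r. prime_word X T h \<and> r > 0 \<and> g = concat (replicate r h)"
  using assms
proof (induction "length g" arbitrary: g rule: less_induct)
  case less
  show ?case
  proof (cases "prime_word X T g")
    case True
    thus ?thesis by (intro exI[of _ g] exI[of _ 1]) simp
  next
    case False
    with less.prems obtain h r where h: "closed_word X T h" "r \<ge> 2" "g = concat (replicate r h)"
      by (auto simp: prime_word_def)
    have "h \<noteq> []" using h by (simp add: closed_word_def)
    hence "length h < length g" using h by simp
    then obtain h' r' where h': "prime_word X T h'" "r' > 0" "h = concat (replicate r' h')"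
      using less.hyps[OF _ h(1)] by blast
    have "g = concat (replicate (r * r') h')"
    proof -
      have "concat (replicate r (concat (replicate r' h'))) = concat (replicate (r * r') h')"
        by (induction r) (simp_all add: replicate_add)
      thus ?thesis using h h' by simp
    qed
    with h h' show ?thesis by (intro exI[of _ h'] exI[of _ "r * r'"]) simp
  qed
qed

lemma closed_word_rotate:
  assumes "closed_word X T g"
  shows "closed_word X T (rotate k g)"
proof -
  have g: "length g > 0" using assms by (auto simp: closed_word_def)
  have "T (rotate k g ! i) (rotate k g ! (Suc i mod length g))" if "i < length g" for i
  proof -
    have "T (g ! ((k + i) mod length g)) (g ! (Suc ((k + i) mod length g) mod length g))"
      using assms g by (simp add: closed_word_def)
    moreover have "Suc ((k + i) mod length g) mod length g = (k + Suc i mod length g) mod length g"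
      by (simp add: mod_Suc_eq mod_add_right_eq)
    ultimately show ?thesis using that g by (simp add: nth_rotate)
  qed
  thus ?thesis using assms by (simp add: closed_word_def)
qed

lemma rotate_inverse: "rotate (length g - k mod length g) (rotate k g) = g"
proof (cases "g = []")
  case False
  hence less: "k mod length g < length g" by simp
  have "rotate (length g - k mod length g) (rotate k g) =
      rotate ((length g - k mod length g + k) mod length g) g"
    by (simp add: rotate_rotate flip: rotate_conv_mod)
  also have "(length g - k mod length g + k) mod length g =
      (length g - k mod length g + k mod length g) mod length g"
    by (simp add: mod_add_right_eq)
  also have "\<dots> = 0" using less by simp
  finally show ?thesis by simp
qed simp

lemma concat_replicate_rotate:
  "rotate k (concat (replicate r h)) = concat (replicate r (rotate k h))"
proof (induction k)
  case (Suc k)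
  have "rotate1 (concat (replicate r x)) = concat (replicate r (rotate1 x))" for x :: "'a list"
  proof (cases x)
    case (Cons a y)
    have "concat (replicate n (a # y)) @ [a] = a # concat (replicate n (y @ [a]))" for n
      by (induction n) auto
    thus ?thesis using Cons by (cases r) auto
  qed simp
  thus ?case using Suc by simp
qed simp

text \<open>Rotation commutes with taking powers, so a proper root of the rotated word rotates back
  to a proper root of \<open>g\<close>.\<close>

lemma prime_word_rotate:
  assumes "prime_word X T g"
  shows "prime_word X T (rotate k g)"
  unfolding prime_word_def
proof (intro conjI notI)
  show "closed_word X T (rotate k g)"
    using assms by (auto simp: prime_word_def intro: closed_word_rotate)
  assume "\<exists>h r. closed_word X T h \<and> r \<ge> 2 \<and> rotate k g = concat (replicate r h)"
  then obtain h r where h: "closed_word X T h" "r \<ge> 2" "rotate k g = concat (replicate r h)"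
    by blast
  have "g = rotate (length g - k mod length g) (rotate k g)"
    by (simp only: rotate_inverse)
  hence "g = concat (replicate r (rotate (length g - k mod length g) h))"
    using h(3) concat_replicate_rotate by metis
  with assms h closed_word_rotate show False unfolding prime_word_def by blast
qed

section \<open>The Euler product over prime words\<close>

text \<open>The relation in the quotient that defines \<open>prime_cycles\<close>, here on lists of
  any type, where it is an equivalence on all lists.\<close>

definition rotation :: "('a list \<times> 'a list) set" where
  "rotation = {(g, h). \<exists>k. h = rotate k g}"

lemma equiv_rotation: "equiv UNIV (rotation :: ('a list \<times> 'a list) set)"
proof (rule equivI)
  show "refl (rotation :: ('a list \<times> 'a list) set)"
    by (rule reflI) (auto simp: rotation_def intro: exI[of _ 0])
  show "sym (rotation :: ('a list \<times> 'a list) set)"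
    by (rule symI) (auto simp: rotation_def intro: rotate_inverse[symmetric])
  show "trans (rotation :: ('a list \<times> 'a list) set)"
    by (rule transI) (auto simp: rotation_def rotate_rotate)
qed simp

text \<open>By aperiodicity the rotations by \<open>0, ..., length g - 1\<close> are pairwise
  distinct. This count is what cancels the length in the Euler product.\<close>

lemma rotation_class_prime_word:
  assumes "prime_word X T g"
  shows "card (rotation `` {g}) = length g" "finite (rotation `` {g})"
proof -
  have g: "g \<noteq> []" using assms by (auto simp: prime_word_def closed_word_def)
  have "i = j" if "rotate i g = rotate j g" "i \<le> j" "j < length g" for i j
  proof -
    have "rotate i g = rotate i (rotate (j - i) g)"
      using that by (simp add: rotate_rotate)
    hence "g = rotate (j - i) g"
      using rotate_inverse[of g i] rotate_inverse[of "rotate (j - i) g" i] by simp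
    with assms have "length g dvd j - i" by (intro prime_word_rotate_eq_self) simp_all
    with that show ?thesis by (auto dest: dvd_imp_le)
  qed
  hence "inj_on (\<lambda>k. rotate k g) {..<length g}"
    by (intro linorder_inj_onI') (metis lessThan_iff less_imp_le order_less_irrefl)
  moreover have "rotation `` {g} = (\<lambda>k. rotate k g) ` {..<length g}"
    using g rotate_conv_mod[of _ g] by (fastforce simp: rotation_def)
  ultimately show "card (rotation `` {g}) = length g" "finite (rotation `` {g})"
    by (simp_all add: card_image)
qed

lemma rotation_class_length: "h \<in> rotation `` {g} \<Longrightarrow> length h = length g"
  by (auto simp: rotation_def)

text \<open>Entries of powers of a 0-1 matrix count walks. The list \<open>zs\<close> holds the
  \<open>m\<close> interior points only, so a walk with one more step is obtained by appending the
  previous endpoint to it.\<close>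

lemma pow_on_eq_card_walks:
  assumes "finite X" "x \<in> X"
  shows "pow_on X (\<lambda>x y. of_bool (T x y)) (Suc m) x y =
    (of_nat (card {zs. length zs = m \<and> set zs \<subseteq> X \<and> successively T (x # zs @ [y])}) :: complex)"
proof (induction m arbitrary: y)
  case 0
  have "{zs. length zs = 0 \<and> set zs \<subseteq> X \<and> successively T (x # zs @ [y])} = (if T x y then {[]} else {})"
    by auto
  moreover have "pow_on X (\<lambda>x y. of_bool (T x y)) (Suc 0) x y = (of_bool (T x y) :: complex)"
    using assms by (simp add: if_distrib[of "\<lambda>a. a * _"] cong: if_cong)
  ultimately show ?case by (simp del: pow_on.simps)
next
  case (Suc m)
  define W where "W m y = {zs. length zs = m \<and> set zs \<subseteq> X \<and> successively T (x # zs @ [y])}" for m y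
  have finW: "finite (W m y)" for m y
    by (rule finite_subset[OF _ finite_lists_length_eq[OF assms(1), of m]]) (auto simp: W_def)
  have "W (Suc m) y = (\<lambda>(k, zs). zs @ [k]) ` (SIGMA k:{k\<in>X. T k y}. W m k)"
  proof (intro equalityI subsetI)
    fix zs assume zs: "zs \<in> W (Suc m) y"
    then obtain ws k where "zs = ws @ [k]" by (cases zs rule: rev_cases) (auto simp: W_def)
    with zs show "zs \<in> (\<lambda>(k, zs). zs @ [k]) ` (SIGMA k:{k\<in>X. T k y}. W m k)"
      by (intro image_eqI[of _ _ "(k, ws)"]) (auto simp: W_def successively_append_iff successively_Cons hd_append)
  qed (auto simp: W_def successively_append_iff successively_Cons hd_append)
  moreover have "inj_on (\<lambda>(k, zs). zs @ [k]) (SIGMA k:{k\<in>X. T k y}. W m k)"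
    by (auto simp: inj_on_def)
  ultimately have "card (W (Suc m) y) = (\<Sum>k | k \<in> X \<and> T k y. card (W m k))"
    using assms(1) finW by (simp add: card_image card_SigmaI)
  also have "of_nat \<dots> = (\<Sum>k\<in>X. of_nat (card (W m k)) * of_bool (T k y) :: complex)"
    using assms(1) unfolding of_nat_sum by (intro sum.mono_neutral_cong_left) auto
  finally show ?case
    using Suc by (subst pow_on.simps) (simp add: W_def del: pow_on.simps)
qed

text \<open>Repeating the first letter at the end turns the cyclic condition into the linear one by
  which walks are counted.\<close>

lemma closed_word_Cons_iff:
  "closed_word X T (x # zs) \<longleftrightarrow> x \<in> X \<and> set zs \<subseteq> X \<and> successively T (x # zs @ [x])"
proof -
  have "(x # zs @ [x]) ! i = (x # zs) ! i" if "i < Suc (length zs)" for i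
    using that by (metis append_Cons length_Cons nth_append)
  moreover have "(x # zs @ [x]) ! Suc i = (x # zs) ! (Suc i mod Suc (length zs))" if "i < Suc (length zs)" for i
    using that by (cases "i = length zs") (auto simp: nth_append)
  ultimately show ?thesis
    unfolding closed_word_def successively_conv_nth by simp
qed

text \<open>A closed word remembers its starting letter, so the count is the full trace: different
  rotations of the same cycle are counted separately.\<close>

lemma card_closed_words:
  assumes "finite X"
  shows "of_nat (card {g. closed_word X T g \<and> length g = Suc m}) =
    (\<Sum>x\<in>X. pow_on X (\<lambda>x y. of_bool (T x y)) (Suc m) x x :: complex)"
proof -
  define W where "W x = {zs. length zs = m \<and> set zs \<subseteq> X \<and> successively T (x # zs @ [x])}" for x
  have finW: "finite (W x)" for x
    by (rule finite_subset[OF _ finite_lists_length_eq[OF assms(1), of m]]) (auto simp: W_def)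
  have "{g. closed_word X T g \<and> length g = Suc m} = (\<lambda>(x, zs). x # zs) ` (SIGMA x:X. W x)"
    by (auto simp: length_Suc_conv closed_word_Cons_iff W_def)
  moreover have "inj_on (\<lambda>(x, zs). x # zs) (SIGMA x:X. W x)"
    by (auto simp: inj_on_def)
  ultimately have "card {g. closed_word X T g \<and> length g = Suc m} = (\<Sum>x\<in>X. card (W x))"
    using assms finW by (simp add: card_image card_SigmaI)
  thus ?thesis
    using assms by (simp add: pow_on_eq_card_walks W_def del: pow_on.simps)
qed

text \<open>There are at most \<open>card X ^ m\<close> words of length \<open>m\<close>, so every
  finite partial sum is dominated by a geometric series.\<close>

lemma summable_on_closed_words:
  assumes "finite X" "real (card X) * norm u < 1"
  shows "(\<lambda>g. norm (u ^ length g / of_nat (length g) :: complex)) summable_on {g. closed_word X T g}"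
proof (rule nonneg_bounded_partial_sums_imp_summable_on)
  define q where "q = real (card X) * norm u"
  have q: "0 \<le> q" "q < 1" using assms by (auto simp: q_def)
  show "\<forall>\<^sub>F F in finite_subsets_at_top {g. closed_word X T g}.
      (\<Sum>g\<in>F. norm (u ^ length g / of_nat (length g))) \<le> 1 / (1 - q)"
  proof (rule eventually_finite_subsets_at_top_weakI)
    fix F assume F: "finite F" "F \<subseteq> {g. closed_word X T g}"
    define M where "M = Suc (Max (length ` F \<union> {0}))"
    have M: "length g < M" if "g \<in> F" for g
      using F that by (auto simp: M_def less_Suc_eq_le intro: Max_ge)
    define L where "L m = {g. set g \<subseteq> X \<and> length g = m}" for m
    have fin: "finite (L m)" for m
      unfolding L_def using assms(1) by (rule finite_lists_length_eq)
    have "(\<Sum>g\<in>F. norm (u ^ length g / of_nat (length g))) \<le> (\<Sum>g\<in>F. norm u ^ length g)"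
    proof (rule sum_mono)
      fix g assume "g \<in> F"
      hence "length g \<ge> 1" using F by (auto simp: closed_word_def Suc_le_eq)
      thus "norm (u ^ length g / of_nat (length g)) \<le> norm u ^ length g"
        by (simp add: norm_divide norm_power divide_le_eq mult_left_le_one_le mult_le_cancel_left1)
    qed
    also have "\<dots> \<le> (\<Sum>g\<in>(\<Union>m<M. L m). norm u ^ length g)"
      using F M fin by (intro sum_mono2) (auto simp: L_def closed_word_def)
    also have "\<dots> = (\<Sum>m<M. \<Sum>g\<in>L m. norm u ^ length g)"
      using fin by (intro sum.UNION_disjoint) (auto simp: L_def)
    also have "\<dots> = (\<Sum>m<M. q ^ m)"
      using card_lists_length_eq[OF assms(1)]
      by (intro sum.cong refl) (simp add: L_def q_def power_mult_distrib)
    also have "\<dots> \<le> 1 / (1 - q)"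
      using q by (simp add: sum_gp_strict divide_right_mono)
    finally show "(\<Sum>g\<in>F. norm (u ^ length g / of_nat (length g))) \<le> 1 / (1 - q)" .
  qed
qed simp

text \<open>Both modes of summation are used: the unordered one for the repetitions of a prime
  class, the ordered one for the sum over word lengths. The index \<open>Suc k\<close> skips the
  degree 0 term.\<close>

lemma has_sum_Ln:
  assumes "norm z < 1"
  shows "((\<lambda>k. z ^ Suc k / of_nat (Suc k)) has_sum - Ln (1 - z :: complex)) UNIV"
    and "(\<lambda>k. z ^ Suc k / of_nat (Suc k)) sums - Ln (1 - z)"
proof -
  have "(\<lambda>n. - ((-1) ^ Suc n / of_nat n * (- z) ^ n)) sums - Ln (1 + (- z))"
    using assms by (intro sums_minus Ln_series) simp
  also have "(\<lambda>n. - ((-1) ^ Suc n / of_nat n * (- z) ^ n)) = (\<lambda>n. z ^ n / of_nat n)"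
    by (rule ext, rename_tac n, case_tac "even n") simp_all
  finally show *: "(\<lambda>k. z ^ Suc k / of_nat (Suc k)) sums - Ln (1 - z)"
    by (subst sums_Suc_iff[of "\<lambda>n. z ^ n / of_nat n"]) simp
  have "summable (\<lambda>k. norm (z ^ Suc k / of_nat (Suc k)))"
  proof (rule summable_comparison_test_ev)
    show "summable (\<lambda>k. norm z ^ k)" using assms by (simp add: summable_geometric)
    have "norm (z ^ Suc k / of_nat (Suc k)) \<le> norm z ^ k" for k
    proof -
      have "norm (z ^ Suc k / of_nat (Suc k)) \<le> norm z ^ Suc k"
        unfolding norm_divide norm_power norm_of_nat
        using divide_left_mono[of 1 "real (Suc k)" "norm z ^ Suc k"] by simp
      also have "\<dots> \<le> norm z ^ k" using assms by (intro power_decreasing) auto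
      finally show ?thesis .
    qed
    thus "\<forall>\<^sub>F k in sequentially. norm (norm (z ^ Suc k / of_nat (Suc k))) \<le> norm z ^ k"
      by simp
  qed
  with * show "((\<lambda>k. z ^ Suc k / of_nat (Suc k)) has_sum - Ln (1 - z)) UNIV"
    by (intro norm_summable_imp_has_sum)
qed


text \<open>Grouping by length replaces the number of words of length \<open>m\<close> by the power
  sum of the \<open>e k\<close>, and each eigenvalue then contributes a logarithm. Existence of the
  sum comes from absolute summability; only its value comes from the grouping.\<close>

lemma has_sum_closed_words:
  assumes "finite X" "real (card X) * norm u < 1" "\<And>k. k < card X \<Longrightarrow> norm (u * e k) < 1"
    and tr: "\<And>m. (\<Sum>x\<in>X. pow_on X (\<lambda>x y. of_bool (T x y)) m x x) = (\<Sum>k<card X. e k ^ m)"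
  shows "((\<lambda>g. u ^ length g / of_nat (length g)) has_sum (\<Sum>k<card X. - Ln (1 - u * e k)))
           {g. closed_word X T g}"
proof -
  define C where "C = {g. closed_word X T g}"
  define f :: "'a list \<Rightarrow> complex" where "f = (\<lambda>g. u ^ length g / of_nat (length g))"
  define S where "S = infsum f C"
  have S: "(f has_sum S) C"
    unfolding S_def f_def C_def
    by (rule has_sum_infsum, rule abs_summable_summable, rule summable_on_closed_words[OF assms(1,2)])
  \<comment> \<open>Closed words are nonempty, so the groups start at length 1 and match the index
    shift in the logarithm series.\<close>
  define Cm where "Cm m = {g \<in> C. length g = Suc m}" for m
  have fin: "finite (Cm m)" for m
    by (rule finite_subset[OF _ finite_lists_length_eq[OF assms(1), of "Suc m"]])
       (auto simp: Cm_def C_def closed_word_def)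
  have bij: "bij_betw snd (SIGMA m:UNIV. Cm m) C"
  proof (rule bij_betw_byWitness[where f' = "\<lambda>g. (length g - 1, g)"])
    show "(\<lambda>g. (length g - 1, g)) ` C \<subseteq> (SIGMA m:UNIV. Cm m)"
      by (auto simp: Cm_def C_def closed_word_def)
  qed (auto simp: Cm_def)
  have "((\<lambda>x. f (snd x)) has_sum S) (SIGMA m:UNIV. Cm m)"
    using S by (simp add: has_sum_reindex_bij_betw[OF bij])
  hence "((\<lambda>m. \<Sum>g\<in>Cm m. f g) has_sum S) UNIV"
    by (rule has_sum_SigmaD) (simp add: fin has_sum_finite)
  hence "(\<lambda>m. \<Sum>g\<in>Cm m. f g) sums S"
    by (rule has_sum_imp_sums)
  also have "(\<lambda>m. \<Sum>g\<in>Cm m. f g) = (\<lambda>m. \<Sum>k<card X. (u * e k) ^ Suc m / of_nat (Suc m))"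
  proof (rule ext)
    fix m
    have "(\<Sum>g\<in>Cm m. f g) = of_nat (card (Cm m)) * (u ^ Suc m / of_nat (Suc m))"
      by (simp add: Cm_def f_def)
    also have "of_nat (card (Cm m)) = (\<Sum>k<card X. e k ^ Suc m)"
      unfolding Cm_def C_def by (simp only: mem_Collect_eq card_closed_words[OF assms(1)] tr)
    also have "\<dots> * (u ^ Suc m / of_nat (Suc m)) = (\<Sum>k<card X. (u * e k) ^ Suc m / of_nat (Suc m))"
      unfolding sum_distrib_right
      by (intro sum.cong refl) (simp only: power_mult_distrib times_divide_eq_right mult.commute)
    finally show "(\<Sum>g\<in>Cm m. f g) = (\<Sum>k<card X. (u * e k) ^ Suc m / of_nat (Suc m))" .
  qed
  finally have "(\<lambda>m. \<Sum>k<card X. (u * e k) ^ Suc m / of_nat (Suc m)) sums S" .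
  moreover have "(\<lambda>m. \<Sum>k<card X. (u * e k) ^ Suc m / of_nat (Suc m)) sums (\<Sum>k<card X. - Ln (1 - u * e k))"
    using assms(3) by (intro sums_sum has_sum_Ln) auto
  ultimately have "S = (\<Sum>k<card X. - Ln (1 - u * e k))"
    by (rule sums_unique2)
  with S show ?thesis by (simp add: f_def C_def)
qed

text \<open>Grouping by primitive root: each closed word is \<open>Suc k\<close> copies of a unique
  prime word \<open>h\<close>, and \<open>h\<close> lies in a unique class \<open>p\<close>. Summing
  over \<open>h\<close> in \<open>p\<close>, then over \<open>k\<close>, leaves one logarithm per
  class.\<close>

lemma has_sum_prime_classes:
  assumes u: "norm u < 1"
    and S: "((\<lambda>g. u ^ length g / of_nat (length g)) has_sum S) {g. closed_word X T g}"
  shows "((\<lambda>p. - Ln (1 - u ^ the_elem (length ` p))) has_sum S)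
           (Collect (prime_word X T) // rotation)"
proof -
  define P where "P = Collect (prime_word X T) // rotation"
  define l where "l p = the_elem (length ` p)" for p :: "'a list set"
  have P: "finite p \<and> card p = l p \<and> l p > 0 \<and> (\<forall>h\<in>p. prime_word X T h \<and> length h = l p \<and> rotation `` {h} = p)"
    if p: "p \<in> P" for p
  proof -
    from p obtain g where g: "prime_word X T g" "p = rotation `` {g}"
      by (auto simp: P_def quotient_def)
    have len: "length h = length g" if "h \<in> p" for h
      using that g rotation_class_length by blast
    have "g \<in> p"
      using g equiv_class_self[OF equiv_rotation] by auto
    hence "length ` p = {length g}" using len by blast
    hence l: "l p = length g" by (simp add: l_def)
    have "rotation `` {h} = p" if "h \<in> p" for h
      using that g equiv_class_eq[OF equiv_rotation] by blast
    moreover have "prime_word X T h" if "h \<in> p" for h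
      using that g prime_word_rotate by (auto simp: rotation_def)
    moreover have "length g > 0" using g by (auto simp: prime_word_def closed_word_def)
    ultimately show ?thesis
      using rotation_class_prime_word[OF g(1)] g(2) l len by auto
  qed
  \<comment> \<open>The index is a class, an exponent shifted by one, and a representative in the
    class; the representative records where the word starts.\<close>
  define F where "F = (\<lambda>((p :: 'a list set, k), h). concat (replicate (Suc k) h) :: 'a list)"
  have bij: "bij_betw F (SIGMA x:P \<times> UNIV. fst x) {g. closed_word X T g}"
    unfolding bij_betw_def
  proof (intro conjI inj_onI equalityI subsetI)
    fix x y assume x: "x \<in> (SIGMA x:P \<times> UNIV. fst x)" and y: "y \<in> (SIGMA x:P \<times> UNIV. fst x)" and eq: "F x = F y"
    obtain p k h where [simp]: "x = ((p, k), h)" by (metis surj_pair)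
    obtain p' k' h' where [simp]: "y = ((p', k'), h')" by (metis surj_pair)
    have "p \<in> P" "p' \<in> P" "h \<in> p" "h' \<in> p'" using x y by auto
    moreover from this have "h = h' \<and> Suc k = Suc k'"
      using P eq by (intro prime_word_power_unique[of X T]) (auto simp: F_def simp del: replicate_Suc)
    ultimately show "x = y" using P[of p] P[of p'] by auto
  next
    fix g assume "g \<in> F ` (SIGMA x:P \<times> UNIV. fst x)"
    then obtain p k h where "p \<in> P" "h \<in> p" "g = concat (replicate (Suc k) h)"
      by (auto simp: F_def)
    thus "g \<in> {g. closed_word X T g}"
      using P[of p] closed_word_concat_replicate_iff[of "Suc k" X T h] by (auto simp: prime_word_def)
  next
    fix g assume "g \<in> {g. closed_word X T g}"
    then obtain h r where h: "prime_word X T h" "r > 0" "g = concat (replicate r h)"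
      using closed_word_prime_power by blast
    have "rotation `` {h} \<in> P" using h by (auto simp: P_def quotient_def)
    moreover have "h \<in> rotation `` {h}" using equiv_class_self[OF equiv_rotation] by auto
    ultimately show "g \<in> F ` (SIGMA x:P \<times> UNIV. fst x)"
      using h by (intro image_eqI[of _ _ "((rotation `` {h}, r - 1), h)"]) (auto simp: F_def simp del: replicate_Suc)
  qed
  define f :: "'a list \<Rightarrow> complex" where "f = (\<lambda>g. u ^ length g / of_nat (length g))"
  have "(f has_sum S) {g. closed_word X T g}" using S by (simp add: f_def)
  hence "((\<lambda>x. f (F x)) has_sum S) (SIGMA x:P \<times> UNIV. fst x)"
    by (simp add: has_sum_reindex_bij_betw[OF bij])
  hence "((\<lambda>x. (u ^ l (fst x)) ^ Suc (snd x) / of_nat (Suc (snd x))) has_sum S) (P \<times> UNIV)"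
  proof (rule has_sum_SigmaD)
    fix x assume "x \<in> P \<times> (UNIV :: nat set)"
    then obtain p k where [simp]: "x = (p, k)" and p: "p \<in> P" by auto
    have "(\<Sum>h\<in>p. f (F ((p, k), h))) = (\<Sum>h\<in>p. (u ^ l p) ^ Suc k / (of_nat (Suc k) * of_nat (l p)))"
    proof (intro sum.cong refl)
      fix h assume "h \<in> p"
      hence "f (F ((p, k), h)) = u ^ (Suc k * l p) / of_nat (Suc k * l p)"
        using P[OF p] by (simp add: f_def F_def del: replicate_Suc mult_Suc)
      also have "u ^ (Suc k * l p) = (u ^ l p) ^ Suc k"
        by (metis power_mult mult.commute)
      finally show "f (F ((p, k), h)) = (u ^ l p) ^ Suc k / (of_nat (Suc k) * of_nat (l p))"
        by (simp only: of_nat_mult)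
    qed
    \<comment> \<open>All \<open>l p\<close> representatives contribute equally, which cancels the
      factor \<open>l p\<close> in the denominator.\<close>
    also have "\<dots> = (u ^ l p) ^ Suc k / of_nat (Suc k)"
      using P[OF p] by (simp del: of_nat_Suc power_Suc add: field_simps)
    finally show "((\<lambda>h. f (F (x, h))) has_sum (u ^ l (fst x)) ^ Suc (snd x) / of_nat (Suc (snd x))) (fst x)"
      using P[OF p] by (simp add: has_sum_finite_iff)
  qed
  hence "((\<lambda>p. - Ln (1 - u ^ l p)) has_sum S) P"
  proof (rule has_sum_SigmaD)
    fix p assume "p \<in> P"
    hence "l p > 0" using P by blast
    hence "norm (u ^ l p) < 1" using u by (simp add: norm_power power_less_one_iff)
    from has_sum_Ln(1)[OF this]
    show "((\<lambda>k. (u ^ l (fst (p, k))) ^ Suc (snd (p, k)) / of_nat (Suc (snd (p, k)))) has_sum - Ln (1 - u ^ l p)) UNIV"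
      by simp
  qed
  thus ?thesis by (simp add: P_def l_def)
qed

text \<open>Both groupings evaluate the same sum, and exponentiating the partial sums over finite
  sets of classes yields the partial products. Since \<open>exp\<close> inverts \<open>Ln\<close> at
  every nonzero argument, the branch of the logarithm does not affect the result.\<close>

theorem euler_product_prime_words:
  fixes T :: "'a \<Rightarrow> 'a \<Rightarrow> bool"
  assumes "finite X"
  shows "\<forall>\<^sub>F u in nhds (0::complex).
    det_on X (\<lambda>x y. (if x = y then 1 else 0) - u * of_bool (T x y)) \<noteq> 0 \<and>
    ((\<lambda>F. \<Prod>p\<in>F. inverse (1 - u ^ the_elem (length ` p))) \<longlongrightarrow>
       inverse (det_on X (\<lambda>x y. (if x = y then 1 else 0) - u * of_bool (T x y))))
      (finite_subsets_at_top (Collect (prime_word X T) // rotation))"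
proof -
  obtain e :: "nat \<Rightarrow> complex" where
    det: "\<And>u. det_on X (\<lambda>x y. (if x = y then 1 else 0) - u * of_bool (T x y)) =
      (\<Prod>k<card X. 1 - u * e k)"
    and tr: "\<And>m. (\<Sum>x\<in>X. pow_on X (\<lambda>x y. of_bool (T x y)) m x x) = (\<Sum>k<card X. e k ^ m)"
    using exists_eigenvalues_on[OF assms, of "\<lambda>x y. of_bool (T x y)"] by blast
  have ev: "\<forall>\<^sub>F u in nhds 0. norm (u * c) < 1" for c :: complex
    unfolding eventually_nhds
    by (rule exI[of _ "{u. norm (u * c) < 1}"]) (auto intro!: open_Collect_less continuous_intros)
  \<comment> \<open>The three bounds serve the logarithm of each prime class, absolute summability
    over all closed words, and the logarithms attached to the eigenvalues.\<close>
  have "\<forall>\<^sub>F u in nhds (0::complex). norm (u * 1) < 1 \<and> norm (u * of_nat (card X)) < 1 \<and>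
      (\<forall>k\<in>{..<card X}. norm (u * e k) < 1)"
    by (intro eventually_conj eventually_ball_finite ballI ev) simp
  thus ?thesis
  proof eventually_elim
    case (elim u)
    let ?S = "\<Sum>k<card X. - Ln (1 - u * e k)"
    have ne: "1 - u * e k \<noteq> 0" if "k < card X" for k
      using elim that by (metis eq_iff_diff_eq_0 lessThan_iff less_irrefl norm_one)
    have "((\<lambda>g. u ^ length g / of_nat (length g)) has_sum ?S) {g. closed_word X T g}"
      using assms elim tr by (intro has_sum_closed_words) (auto simp: norm_mult mult.commute)
    hence "((\<lambda>p. - Ln (1 - u ^ the_elem (length ` p))) has_sum ?S) (Collect (prime_word X T) // rotation)"
      using elim by (intro has_sum_prime_classes) simp_all
    hence "((\<lambda>F. exp (\<Sum>p\<in>F. - Ln (1 - u ^ the_elem (length ` p)))) \<longlongrightarrow> exp ?S)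
        (finite_subsets_at_top (Collect (prime_word X T) // rotation))"
      unfolding has_sum_def by (rule tendsto_exp)
    moreover have "exp ?S = inverse (\<Prod>k<card X. 1 - u * e k)"
      using ne by (simp add: exp_sum exp_minus prod_inversef[symmetric] o_def)
    moreover have "\<forall>\<^sub>F F in finite_subsets_at_top (Collect (prime_word X T) // rotation).
        exp (\<Sum>p\<in>F. - Ln (1 - u ^ the_elem (length ` p))) =
        (\<Prod>p\<in>F. inverse (1 - u ^ the_elem (length ` p)))"
    proof (rule eventually_finite_subsets_at_top_weakI)
      fix F assume F: "finite F" "F \<subseteq> Collect (prime_word X T) // rotation"
      have "1 - u ^ the_elem (length ` p) \<noteq> 0" if "p \<in> F" for p
      proof -
        from that F obtain g where g: "prime_word X T g" "p = rotation `` {g}"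
          by (auto simp: quotient_def)
        have "g \<in> p" using g equiv_class_self[OF equiv_rotation] by auto
        hence "length ` p = {length g}" using g rotation_class_length by blast
        moreover have "length g > 0" using g by (auto simp: prime_word_def closed_word_def)
        ultimately have "norm (u ^ the_elem (length ` p)) < 1"
          using elim by (simp add: norm_power power_less_one_iff)
        thus ?thesis by (metis eq_iff_diff_eq_0 less_irrefl norm_one)
      qed
      thus "exp (\<Sum>p\<in>F. - Ln (1 - u ^ the_elem (length ` p))) =
        (\<Prod>p\<in>F. inverse (1 - u ^ the_elem (length ` p)))"
        using F(1) by (subst exp_sum) (auto simp: exp_minus intro!: prod.cong)
    qed
    ultimately have "((\<lambda>F. \<Prod>p\<in>F. inverse (1 - u ^ the_elem (length ` p))) \<longlongrightarrow>
        inverse (\<Prod>k<card X. 1 - u * e k)) (finite_subsets_at_top (Collect (prime_word X T) // rotation))"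
      by (simp add: filterlim_cong)
    thus ?case using ne by (simp add: det)
  qed
qed

section \<open>The flag determinant of a biregular incidence relation\<close>

text \<open>An Ihara-Bass formula for a biregular bipartite graph. The power of \<open>1 - u\<close>
  combines the \<open>b - 1\<close> equal eigenvalues of each block over \<open>W\<close> with the
  normalising factor of the matrix on \<open>V\<close>; the power of \<open>1 + (b - 1) u\<close> is
  one factor per element of \<open>W\<close>, less one per element of \<open>V\<close>.\<close>

lemma det_on_flags:
  fixes inc :: "'v \<Rightarrow> 'w \<Rightarrow> bool" and u :: complex and a b :: nat
  assumes fin: "finite V" "finite W"
    and a: "\<And>v. v \<in> V \<Longrightarrow> card {w\<in>W. inc v w} = a"
    and b: "\<And>w. w \<in> W \<Longrightarrow> card {v\<in>V. inc v w} = b"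
    and u: "u \<noteq> 1" "1 + (of_nat b - 1) * u \<noteq> 0"
  defines "X \<equiv> {(v, w). v \<in> V \<and> w \<in> W \<and> inc v w}"
  shows "det_on X (\<lambda>f f'. (if f = f' then 1 else 0) -
           u * of_bool (inc (fst f') (snd f) \<and> fst f \<noteq> fst f' \<and> snd f \<noteq> snd f')) =
    (1 - u) powi (int (card X) - int (card V) - int (card W)) *
    (1 + (of_nat b - 1) * u) powi (int (card W) - int (card V)) *
    det_on V (\<lambda>v v'. (if v = v' then (1 + (of_nat a - 1) * u) * (1 + (of_nat b - 1) * u) else 0) -
           u * (\<Sum>w\<in>W. of_bool (inc v w) * of_bool (inc v' w)))"
proof -
  define s t where "s = 1 - u" and "t = 1 + (of_nat b - 1) * u"
  have nz: "s \<noteq> 0" "t \<noteq> 0" using u by (auto simp: s_def t_def)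
  have s_eq: "s = 1 - u" by (simp add: s_def)
  have t_eq: "t = s + u * of_nat b" by (simp add: s_def t_def algebra_simps)
  define x y where "x = - (1 / s)" and "y = 1 / (s * t)"
  have finX: "finite X"
    by (rule finite_subset[of _ "V \<times> W"]) (auto simp: X_def fin)
  have sum_V: "(\<Sum>f\<in>X. if snd f = w then h (fst f) else 0) = (\<Sum>v | v \<in> V \<and> inc v w. h v)"
    if "w \<in> W" for w and h :: "'v \<Rightarrow> complex"
  proof -
    have "(\<Sum>f\<in>X. if snd f = w then h (fst f) else 0) = (\<Sum>f | f \<in> X \<and> snd f = w. h (fst f))"
      using finX by (simp add: sum.inter_filter)
    also have "\<dots> = (\<Sum>v | v \<in> V \<and> inc v w. h v)"
      using that by (intro sum.reindex_bij_witness[of _ "\<lambda>v. (v, w)" fst]) (auto simp: X_def)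
    finally show ?thesis .
  qed
  have sum_W: "(\<Sum>f\<in>X. if fst f = v then h (snd f) else 0) = (\<Sum>w | w \<in> W \<and> inc v w. h w)"
    if "v \<in> V" for v and h :: "'w \<Rightarrow> complex"
  proof -
    have "(\<Sum>f\<in>X. if fst f = v then h (snd f) else 0) = (\<Sum>f | f \<in> X \<and> fst f = v. h (snd f))"
      using finX by (simp add: sum.inter_filter)
    also have "\<dots> = (\<Sum>w | w \<in> W \<and> inc v w. h w)"
      using that by (intro sum.reindex_bij_witness[of _ "\<lambda>w. (v, w)" snd]) (auto simp: X_def)
    finally show ?thesis .
  qed

  \<comment> \<open>\<open>1 - uT = M M'\<close>, where \<open>M\<close> only mixes flags with the same \<open>w\<close>, and \<open>M' - 1\<close> factors through \<open>V\<close>. The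
    constants \<open>x\<close> and \<open>y\<close> are the solution of \<open>M K = [inc v w] - [v = v']\<close>.\<close>
  define M where "M f f' = (if f = f' then s else 0) + (if snd f = snd f' then u else 0)"
    for f f' :: "'v \<times> 'w"
  \<comment> \<open>\<open>M\<close> is \<open>s\<close> times the identity minus a product through
    \<open>W\<close>. On \<open>W\<close> the matrix left by Sylvester's identity is diagonal with
    entries \<open>1 + u b / s = t / s\<close>, because each element of \<open>W\<close> carries
    \<open>b\<close> flags.\<close>
  have "det_on X M = det_on X (\<lambda>f f'. s * ((if f = f' then 1 else 0) -
      (\<Sum>w\<in>W. (if snd f = w then - (u / s) else 0) * (if w = snd f' then 1 else 0))))"
    using fin nz
    by (intro det_on_cong) (auto simp: M_def X_def if_distrib[of "\<lambda>a. _ * a"] field_simps cong: if_cong)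
  also have "\<dots> = s ^ card X * det_on W (\<lambda>w w'. (if w = w' then 1 else 0) -
      (\<Sum>f\<in>X. (if w = snd f then 1 else 0) * (if snd f = w' then - (u / s) else 0)))"
    unfolding det_on_scale using finX fin by (subst det_on_sylvester) auto
  also have "det_on W (\<lambda>w w'. (if w = w' then 1 else 0) -
      (\<Sum>f\<in>X. (if w = snd f then 1 else 0) * (if snd f = w' then - (u / s) else 0))) =
      det_on W (\<lambda>w w'. if w = w' then t / s else 0)"
  proof (rule det_on_cong)
    fix w w' assume w: "w \<in> W" "w' \<in> W"
    have "(\<Sum>f\<in>X. (if w = snd f then 1 else 0) * (if snd f = w' then - (u / s) else 0)) =
        (\<Sum>f\<in>X. if snd f = w then (if w = w' then - (u / s) else 0) else 0)"
      by (intro sum.cong) auto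
    also have "\<dots> = (if w = w' then - (u / s) * of_nat b else 0)"
      using b[OF w(1)] by (simp add: sum_V[OF w(1), of "\<lambda>_. if w = w' then - (u / s) else 0"])
    finally have eq: "(\<Sum>f\<in>X. (if w = snd f then 1 else 0) * (if snd f = w' then - (u / s) else 0)) =
        (if w = w' then - (u / s) * of_nat b else 0)" .
    show "(if w = w' then 1 else 0) -
        (\<Sum>f\<in>X. (if w = snd f then 1 else 0) * (if snd f = w' then - (u / s) else 0)) =
        (if w = w' then t / s else 0)"
      unfolding eq using nz by (simp add: t_eq field_simps)
  qed
  finally have det_M: "det_on X M = s ^ card X * (t / s) ^ card W"
    using fin by (simp add: det_on_diag)

  define K where "K f v = (if fst f = v then x else 0) + (if inc v (snd f) then y else 0)"
    for f :: "'v \<times> 'w" and v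
  define M' where "M' f f' = (if f = f' then 1 else 0) -
    (\<Sum>v\<in>V. u * K f v * (if v = fst f' then 1 else 0))" for f f'
  have "det_on X M' = det_on V (\<lambda>v v'. (if v = v' then 1 else 0) -
      (\<Sum>f\<in>X. (if v = fst f then 1 else 0) * (u * K f v')))"
    unfolding M'_def using finX fin by (subst det_on_sylvester) auto
  \<comment> \<open>Summing \<open>K\<close> over the \<open>a\<close> flags at \<open>v\<close>
    gives \<open>a x\<close> on the diagonal plus \<open>y\<close> times the number of common
    elements of \<open>W\<close>. Extracting \<open>y = 1 / (s t)\<close> turns the diagonal part
    into \<open>t (s + u a)\<close>, and \<open>s + u a = 1 + (a - 1) u\<close>.\<close>
  also have "\<dots> = det_on V (\<lambda>v v'. y * ((if v = v' then (1 + (of_nat a - 1) * u) * t else 0) -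
      u * (\<Sum>w\<in>W. of_bool (inc v w) * of_bool (inc v' w))))"
  proof (rule det_on_cong)
    fix v v' assume v: "v \<in> V" "v' \<in> V"
    have "(\<Sum>f\<in>X. (if v = fst f then 1 else 0) * (u * K f v')) =
        (\<Sum>f\<in>X. if fst f = v then u * ((if v = v' then x else 0) + y * of_bool (inc v' (snd f))) else 0)"
      by (intro sum.cong) (auto simp: K_def)
    also have "\<dots> = (\<Sum>w | w \<in> W \<and> inc v w. u * ((if v = v' then x else 0) + y * of_bool (inc v' w)))"
      by (rule sum_W[OF v(1)])
    also have "\<dots> = (if v = v' then u * x * of_nat a else 0) + u * y * (\<Sum>w | w \<in> W \<and> inc v w. of_bool (inc v' w))"
      using a[OF v(1)] by (simp add: sum.distrib ring_distribs sum_distrib_left mult_ac)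
    also have "(\<Sum>w | w \<in> W \<and> inc v w. of_bool (inc v' w) :: complex) = (\<Sum>w\<in>W. of_bool (inc v w) * of_bool (inc v' w))"
      using fin by (intro sum.mono_neutral_cong_left) auto
    finally have eq: "(\<Sum>f\<in>X. (if v = fst f then 1 else 0) * (u * K f v')) =
        (if v = v' then u * x * of_nat a else 0) +
        u * y * (\<Sum>w\<in>W. of_bool (inc v w) * of_bool (inc v' w))" .
    have "1 + (of_nat a - 1) * u = s + u * of_nat a"
      by (simp add: s_def algebra_simps)
    thus "(if v = v' then 1 else 0) - (\<Sum>f\<in>X. (if v = fst f then 1 else 0) * (u * K f v')) =
        y * ((if v = v' then (1 + (of_nat a - 1) * u) * t else 0) -
          u * (\<Sum>w\<in>W. of_bool (inc v w) * of_bool (inc v' w)))"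
      unfolding eq using nz by (simp add: x_def y_def field_simps) (simp add: s_def algebra_simps)
  qed
  finally have det_M': "det_on X M' = y ^ card V * det_on V (\<lambda>v v'.
      (if v = v' then (1 + (of_nat a - 1) * u) * t else 0) -
      u * (\<Sum>w\<in>W. of_bool (inc v w) * of_bool (inc v' w)))"
    by (simp only: det_on_scale)

  have "det_on X (\<lambda>f f'. (if f = f' then 1 else 0) -
      u * of_bool (inc (fst f') (snd f) \<and> fst f \<noteq> fst f' \<and> snd f \<noteq> snd f')) =
      det_on X (\<lambda>f f'. \<Sum>g\<in>X. M f g * M' g f')"
  proof (rule det_on_cong)
    fix f f' assume f: "f \<in> X" "f' \<in> X"
    have M': "M' g f' = (if g = f' then 1 else 0) - u * K g (fst f')" for g
      using f fin unfolding M'_def X_def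
      by (auto simp: if_distrib[of "\<lambda>a. _ * a"] cong: if_cong)
    have fV: "snd f \<in> W" using f by (auto simp: X_def)
    have "(\<Sum>g\<in>X. M f g * M' g f') = (\<Sum>g\<in>X. if g = f' then M f g else 0) - u * (\<Sum>g\<in>X. M f g * K g (fst f'))"
      unfolding M' by (simp add: right_diff_distrib sum_subtractf sum_distrib_left mult_ac if_distrib[of "\<lambda>a. _ * a"] cong: if_cong)
    also have "(\<Sum>g\<in>X. if g = f' then M f g else 0) = M f f'"
      using f finX by simp
    also have "(\<Sum>g\<in>X. M f g * K g (fst f')) =
        (\<Sum>g\<in>X. if g = f then s * K f (fst f') else 0) +
        (\<Sum>g\<in>X. if snd g = snd f then
          u * ((if fst g = fst f' then x else 0) + (if inc (fst f') (snd f) then y else 0)) else 0)"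
      unfolding sum.distrib[symmetric] by (intro sum.cong) (auto simp: M_def K_def ring_distribs)
    also have "(\<Sum>g\<in>X. if snd g = snd f then u * ((if fst g = fst f' then x else 0) + (if inc (fst f') (snd f) then y else 0)) else 0) =
        (\<Sum>v | v \<in> V \<and> inc v (snd f). u * ((if v = fst f' then x else 0) + (if inc (fst f') (snd f) then y else 0)))"
      by (rule sum_V[OF fV])
    also have "\<dots> = u * ((if inc (fst f') (snd f) then x else 0) + of_nat b * (if inc (fst f') (snd f) then y else 0))"
      using b[OF fV] f fin by (auto simp: sum_distrib_left[symmetric] sum.distrib X_def)
    finally have "(\<Sum>g\<in>X. M f g * M' g f') =
        M f f' - u * (s * K f (fst f') + u * ((if inc (fst f') (snd f) then x else 0) +
          of_nat b * (if inc (fst f') (snd f) then y else 0)))"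
      using f finX by simp
    also have "s * K f (fst f') + u * ((if inc (fst f') (snd f) then x else 0) +
          of_nat b * (if inc (fst f') (snd f) then y else 0)) =
        (if fst f = fst f' then s * x else 0) + (if inc (fst f') (snd f) then s * y + u * x + u * of_nat b * y else 0)"
      by (simp add: K_def ring_distribs)
    \<comment> \<open>The two equations that determine \<open>x\<close> and \<open>y\<close>: the
      coefficient of \<open>[v = v']\<close> is \<open>-1\<close>, that of the incidence indicator
      is \<open>1\<close>.\<close>
    also have "s * x = -1"
      using nz by (simp add: x_def)
    also have "s * y + u * x + u * of_nat b * y = 1"
    proof -
      have "s * y + u * x + u * of_nat b * y = y * t + u * x"
        by (simp add: t_eq algebra_simps)
      also have "y * t = 1 / s" using nz by (simp add: y_def)
      finally show ?thesis using nz by (simp add: x_def field_simps) (simp add: s_eq)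
    qed
    \<comment> \<open>Inclusion-exclusion: two flags sharing either component satisfy the incidence
      condition automatically, and sharing both means equality.\<close>
    finally show "(if f = f' then 1 else 0) -
      u * of_bool (inc (fst f') (snd f) \<and> fst f \<noteq> fst f' \<and> snd f \<noteq> snd f') = (\<Sum>g\<in>X. M f g * M' g f')"
      using f by (auto simp: M_def X_def s_eq)
  qed
  also have "\<dots> = det_on X M * det_on X M'"
    using finX by (rule det_on_mult)
  also have "\<dots> = s powi (int (card X) - int (card V) - int (card W)) * t powi (int (card W) - int (card V)) *
      det_on V (\<lambda>v v'. (if v = v' then (1 + (of_nat a - 1) * u) * t else 0) -
        u * (\<Sum>w\<in>W. of_bool (inc v w) * of_bool (inc v' w)))"
    unfolding det_M det_M' using nz
    by (simp add: power_int_diff power_int_add y_def field_simps)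
  finally show ?thesis unfolding s_def t_def .
qed

section \<open>Cubes in combinatorial coordinates\<close>

text \<open>Unit arcs labelled by their starting point \<open>j\<close>; the last one wraps around
  to 0. The labels let cubes be handled as points of a finite grid.\<close>

definition arc :: "nat \<Rightarrow> nat \<Rightarrow> real set" where
  "arc m j = (\<lambda>x. x rmod real m) ` {real j..real j + 1}"

text \<open>The reduction modulo \<open>m\<close> moves only the endpoint \<open>m\<close> of the
  last arc, which becomes 0.\<close>

lemma mem_arc_iff:
  assumes "j < m" "0 \<le> t" "t < real m"
  shows "t \<in> arc m j \<longleftrightarrow> t \<in> {real j..real j + 1} \<or> (Suc j = m \<and> t = 0)"
proof -
  have rmod: "s rmod real m = (if s = real m then 0 else s)" if "s \<in> {real j..real j + 1}" for s
  proof -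
    have "real j + 1 \<le> real m" using assms(1) by linarith
    with that have "0 \<le> s" "s \<le> real m" by auto
    thus ?thesis by (auto simp: rmod_idem)
  qed
  have "t \<in> arc m j \<longleftrightarrow> (\<exists>s\<in>{real j..real j + 1}. t = (if s = real m then 0 else s))"
    unfolding arc_def image_iff by (intro bex_cong refl) (simp add: rmod)
  also have "\<dots> \<longleftrightarrow> t \<in> {real j..real j + 1} \<or> (Suc j = m \<and> t = 0)"
  proof (intro iffI; elim bexE disjE conjE)
    fix s assume "s \<in> {real j..real j + 1}" "t = (if s = real m then 0 else s)"
    thus "t \<in> {real j..real j + 1} \<or> (Suc j = m \<and> t = 0)"
      using assms(1) by (auto split: if_splits)
  next
    assume "t \<in> {real j..real j + 1}"
    thus "\<exists>s\<in>{real j..real j + 1}. t = (if s = real m then 0 else s)"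
      using assms by (intro bexI[of _ t]) auto
  next
    assume "Suc j = m" "t = 0"
    thus "\<exists>s\<in>{real j..real j + 1}. t = (if s = real m then 0 else s)"
      by (intro bexI[of _ "real m"]) auto
  qed
  finally show ?thesis .
qed

lemma of_nat_mem_arc_iff:
  assumes "j < m" "k < m"
  shows "real k \<in> arc m j \<longleftrightarrow> k = j \<or> k = Suc j mod m"
proof -
  have "real k \<in> arc m j \<longleftrightarrow> k = j \<or> k = Suc j \<or> (Suc j = m \<and> k = 0)"
    using assms by (subst mem_arc_iff) auto
  also have "\<dots> \<longleftrightarrow> k = j \<or> k = Suc j mod m"
    using assms by (cases "Suc j = m") auto
  finally show ?thesis .
qed

text \<open>The midpoint identifies the arc. Grid points would not suffice: for \<open>m = 2\<close>
  both arcs contain 0 and 1.\<close>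

lemma arc_subset_iff:
  assumes "j < m" "k < m"
  shows "arc m j \<subseteq> arc m k \<longleftrightarrow> j = k"
proof
  have "real j + 1/2 \<in> arc m j"
    using assms by (subst mem_arc_iff) auto
  moreover assume "arc m j \<subseteq> arc m k"
  ultimately have "real j + 1/2 \<in> arc m k" by blast
  moreover have "real j + 1/2 < real m" using assms by linarith
  ultimately have "real j + 1/2 \<in> {real k..real k + 1}"
    using assms by (subst (asm) mem_arc_iff) auto
  thus "j = k" by auto
qed simp

lemma Suc_mod_neq:
  assumes "2 \<le> m" "j < (m :: nat)"
  shows "Suc j mod m \<noteq> j"
  using assms by (cases "Suc j = m") auto

text \<open>Adding \<open>m\<close> before subtracting 1 avoids truncated subtraction at
  \<open>k = 0\<close>.\<close>

lemma pred_mod_eq_iff: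
  assumes "j < m" "k < (m :: nat)"
  shows "k = Suc j mod m \<longleftrightarrow> j = (k + m - 1) mod m"
proof -
  have "(k + m - 1) mod m = (if k = 0 then m - 1 else k - 1)"
    using assms by (cases k) auto
  moreover have "Suc j mod m = (if Suc j = m then 0 else Suc j)"
    using assms by auto
  ultimately show ?thesis using assms by auto
qed

text \<open>A cube is coded by its set of directions and its base corner in the grid, the corner at
  which all its arcs start.\<close>

definition side :: "(nat \<Rightarrow> nat) \<Rightarrow> nat set \<times> (nat \<Rightarrow> nat) \<Rightarrow> nat \<Rightarrow> real set" where
  "side n s i = (if i \<in> fst s then arc (n i) (snd s i) else {real (snd s i)})"

definition cube :: "nat \<Rightarrow> (nat \<Rightarrow> nat) \<Rightarrow> nat set \<times> (nat \<Rightarrow> nat) \<Rightarrow> (nat \<Rightarrow> real) set" where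
  "cube q n s = PiE {1..q} (side n s)"

definition grid :: "nat \<Rightarrow> (nat \<Rightarrow> nat) \<Rightarrow> (nat \<Rightarrow> nat) set" where
  "grid q n = (\<Pi>\<^sub>E i\<in>{1..q}. {..<n i})"

lemma finite_grid [simp]: "finite (grid q n)"
  by (simp add: grid_def finite_PiE)

lemma finite_simplices [simp]: "finite (simplices q k)"
  by (rule finite_subset[of _ "Pow {1..q}"]) (auto simp: simplices_def)

lemma simplices_of_nat: "simplices q (int k - 1) = {\<sigma>. \<sigma> \<subseteq> {1..q} \<and> card \<sigma> = k}"
  by (auto simp: simplices_def)

lemma card_simplices: "card (simplices q (int k - 1)) = q choose k"
  by (simp add: simplices_of_nat n_subsets)

lemma card_grid: "int (card (grid q n)) = torus_size q n"
  by (simp add: grid_def torus_size_def card_PiE)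

locale torus =
  fixes q :: nat and n :: "nat \<Rightarrow> nat"
  assumes side_lengths: "i \<in> {1..q} \<Longrightarrow> n i \<ge> 2"
begin

abbreviation "G \<equiv> grid q n"

lemma grid_less: "x \<in> G \<Longrightarrow> i \<in> {1..q} \<Longrightarrow> x i < n i"
  by (auto simp: grid_def)

lemma fun_upd_grid: "x \<in> G \<Longrightarrow> i \<in> {1..q} \<Longrightarrow> k < n i \<Longrightarrow> x(i := k) \<in> G"
  by (auto simp: grid_def PiE_iff extensional_def)

lemma mod_less_side: "i \<in> {1..q} \<Longrightarrow> k mod n i < n i"
  using side_lengths[of i] by (intro mod_less_divisor) auto

lemma side_subset_iff:
  assumes "x \<in> G" "y \<in> G" "i \<in> {1..q}"
  shows "side n (\<rho>, x) i \<subseteq> side n (\<eta>, y) i \<longleftrightarrow>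
    (i \<in> \<rho> \<longrightarrow> i \<in> \<eta>) \<and> (x i = y i \<or> i \<in> \<eta> - \<rho> \<and> x i = Suc (y i) mod n i)"
proof -
  have less: "x i < n i" "y i < n i" using assms grid_less by auto
  have ne: "Suc (x i) mod n i \<noteq> x i" "Suc (x i) mod n i < n i"
    using less assms side_lengths mod_less_side by (auto simp: Suc_mod_neq)
  \<comment> \<open>An arc contains two distinct grid points, here by the bound
    \<open>n i \<ge> 2\<close>, so it cannot lie in a single point.\<close>
  have "real (x i) \<in> arc (n i) (x i)" "real (Suc (x i) mod n i) \<in> arc (n i) (x i)"
    using less ne by (simp_all add: of_nat_mem_arc_iff)
  hence "\<not> arc (n i) (x i) \<subseteq> {real (y i)}"
    using ne(1) by (metis of_nat_eq_iff singletonD subsetD)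
  thus ?thesis
    using less by (auto simp: side_def arc_subset_iff of_nat_mem_arc_iff)
qed

lemma side_nonempty: "x \<in> G \<Longrightarrow> side n (\<rho>, x) i \<noteq> {}"
  by (simp add: side_def arc_def)

lemma cube_subset_iff:
  assumes "x \<in> G" "y \<in> G"
  shows "cube q n (\<rho>, x) \<subseteq> cube q n (\<eta>, y) \<longleftrightarrow>
    (\<forall>i\<in>{1..q}. (i \<in> \<rho> \<longrightarrow> i \<in> \<eta>) \<and> (x i = y i \<or> i \<in> \<eta> - \<rho> \<and> x i = Suc (y i) mod n i))"
proof -
  have "cube q n (\<rho>, x) \<subseteq> cube q n (\<eta>, y) \<longleftrightarrow> (\<forall>i\<in>{1..q}. side n (\<rho>, x) i \<subseteq> side n (\<eta>, y) i)"
    unfolding cube_def subset_PiE using side_nonempty[OF assms(1)] by (auto simp: PiE_eq_empty_iff)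
  also have "\<dots> \<longleftrightarrow> (\<forall>i\<in>{1..q}. (i \<in> \<rho> \<longrightarrow> i \<in> \<eta>) \<and>
      (x i = y i \<or> i \<in> \<eta> - \<rho> \<and> x i = Suc (y i) mod n i))"
    using assms by (intro ball_cong refl side_subset_iff)
  finally show ?thesis .
qed

text \<open>Codimension-one inclusion in coordinates: collapsing direction \<open>i\<close> gives
  the near face, with the same base corner, or the far face, with the corner moved one step
  cyclically.\<close>

definition inc :: "nat set \<times> (nat \<Rightarrow> nat) \<Rightarrow> nat set \<times> (nat \<Rightarrow> nat) \<Rightarrow> bool" where
  "inc s t \<longleftrightarrow> (\<exists>i\<in>fst t. fst s = fst t - {i} \<and>
     (snd s = snd t \<or> snd s = (snd t)(i := Suc (snd t i) mod n i)))"

text \<open>The cardinalities leave exactly one extra direction, and only in that coordinate can the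
  base corners differ.\<close>

lemma cube_subset_iff_inc:
  assumes "s \<in> simplices q (int k - 1) \<times> G" "t \<in> simplices q (int (Suc k) - 1) \<times> G"
  shows "cube q n s \<subseteq> cube q n t \<longleftrightarrow> inc s t"
proof -
  obtain \<rho> x \<eta> y where st [simp]: "s = (\<rho>, x)" "t = (\<eta>, y)" by (metis surj_pair)
  have \<rho>: "\<rho> \<subseteq> {1..q}" "card \<rho> = k" and \<eta>: "\<eta> \<subseteq> {1..q}" "card \<eta> = Suc k" and xy: "x \<in> G" "y \<in> G"
    using assms unfolding simplices_of_nat by auto
  have fin: "finite \<rho>" "finite \<eta>" using \<rho> \<eta> finite_subset by auto
  show ?thesis
  proof
    assume "cube q n s \<subseteq> cube q n t"
    hence *: "\<forall>i\<in>{1..q}. (i \<in> \<rho> \<longrightarrow> i \<in> \<eta>) \<and> (x i = y i \<or> i \<in> \<eta> - \<rho> \<and> x i = Suc (y i) mod n i)"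
      by (simp add: cube_subset_iff[OF xy])
    have sub: "\<rho> \<subseteq> \<eta>" using * \<rho> by blast
    hence "card (\<eta> - \<rho>) = 1" using fin \<rho> \<eta> by (simp add: card_Diff_subset)
    then obtain i where i: "\<eta> - \<rho> = {i}" by (rule card_1_singletonE)
    have xj: "x j = (if j = i then x i else y j)" for j
    proof (cases "j \<in> {1..q}")
      case True
      with * i show ?thesis by auto
    next
      case False
      thus ?thesis using xy i by (auto simp: grid_def PiE_iff extensional_def)
    qed
    have x: "x = y(i := x i)"
      by (rule ext, unfold fun_upd_apply) (rule xj)
    have "i \<in> {1..q}" using i \<eta> by blast
    hence "x i = y i \<or> x i = Suc (y i) mod n i" using * by blast
    with x have "x = y \<or> x = y(i := Suc (y i) mod n i)" by (metis fun_upd_triv)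
    moreover have "i \<in> \<eta>" "\<rho> = \<eta> - {i}" using i sub by auto
    ultimately show "inc s t" by (auto simp: inc_def)
  next
    assume "inc s t"
    thus "cube q n s \<subseteq> cube q n t"
      by (auto simp: inc_def cube_subset_iff[OF xy] split: if_splits)
  qed
qed

lemma cube_inj_on: "inj_on (cube q n) (Pow {1..q} \<times> G)"
proof (rule inj_onI)
  fix s t assume st: "s \<in> Pow {1..q} \<times> G" "t \<in> Pow {1..q} \<times> G" "cube q n s = cube q n t"
  obtain \<rho> x \<eta> y where [simp]: "s = (\<rho>, x)" "t = (\<eta>, y)" by (metis surj_pair)
  have xy: "x \<in> G" "y \<in> G" using st by auto
  have "cube q n (\<rho>, x) \<subseteq> cube q n (\<eta>, y)" "cube q n (\<eta>, y) \<subseteq> cube q n (\<rho>, x)"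
    using st by auto
  hence *: "(i \<in> \<rho> \<longleftrightarrow> i \<in> \<eta>) \<and> x i = y i" if "i \<in> {1..q}" for i
    using that xy by (auto simp: cube_subset_iff)
  hence "\<rho> = \<eta>" using st by auto
  moreover have "x = y"
    using xy * unfolding grid_def by (intro PiE_ext) auto
  ultimately show "s = t" by simp
qed

lemma cubes_eq: "cubes q n k = cube q n ` (simplices q (int k - 1) \<times> G)"
proof (intro equalityI subsetI)
  fix c assume "c \<in> cubes q n k"
  then obtain \<sigma> I where \<sigma>: "\<sigma> \<in> simplices q (int k - 1)" and c: "c = PiE {1..q} I"
    and I: "\<And>i. i \<in> {1..q} \<Longrightarrow> I i \<in> (if i \<in> \<sigma> then unit_arcs (n i) else unit_points (n i))"
    by (auto simp: cubes_def cubes_along_def)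
  have "\<exists>j<n i. I i = (if i \<in> \<sigma> then arc (n i) j else {real j})" if "i \<in> {1..q}" for i
    using I[OF that] by (auto simp: unit_arcs_def unit_points_def arc_def split: if_splits)
  then obtain y where y: "\<And>i. i \<in> {1..q} \<Longrightarrow> y i < n i \<and> I i = (if i \<in> \<sigma> then arc (n i) (y i) else {real (y i)})"
    by metis
  have "c = cube q n (\<sigma>, restrict y {1..q})"
    unfolding c cube_def by (intro PiE_cong) (simp add: y side_def)
  moreover have "restrict y {1..q} \<in> G" using y by (auto simp: grid_def)
  ultimately show "c \<in> cube q n ` (simplices q (int k - 1) \<times> G)" using \<sigma> by blast
next
  fix c assume "c \<in> cube q n ` (simplices q (int k - 1) \<times> G)"
  then obtain \<sigma> y where \<sigma>: "\<sigma> \<in> simplices q (int k - 1)" and y: "y \<in> G" and c: "c = cube q n (\<sigma>, y)"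
    by auto
  have "side n (\<sigma>, y) i \<in> (if i \<in> \<sigma> then unit_arcs (n i) else unit_points (n i))" if "i \<in> {1..q}" for i
    using grid_less[OF y that] by (auto simp: side_def arc_def unit_arcs_def unit_points_def)
  hence "c \<in> cubes_along q n \<sigma>"
    unfolding cubes_along_def c cube_def by blast
  with \<sigma> show "c \<in> cubes q n k"
    unfolding cubes_def by blast
qed

lemma bij_betw_cube: "bij_betw (cube q n) (simplices q (int k - 1) \<times> G) (cubes q n k)"
  unfolding bij_betw_def cubes_eq
  by (intro conjI refl inj_on_subset[OF cube_inj_on]) (auto simp: simplices_def)

lemma card_cubes: "int (card (cubes q n k)) = int (q choose k) * torus_size q n"
proof -
  have "card (cubes q n k) = (q choose k) * card G"
    using bij_betw_same_card[OF bij_betw_cube, of k]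
    by (simp add: card_cartesian_product card_simplices)
  thus ?thesis by (simp flip: card_grid)
qed

text \<open>The weight \<open>h\<close> is arbitrary so that one enumeration serves both the degree
  count, with weight 1, and the action on characters. Near and far face are distinct because a
  cyclic step moves every coordinate when sides are at least 2.\<close>

lemma sum_faces:
  fixes h :: "_ \<Rightarrow> 'a::comm_monoid_add"
  assumes \<eta>: "\<eta> \<in> simplices q (int (Suc k) - 1)" and y: "y \<in> G"
  shows "(\<Sum>s | s \<in> simplices q (int k - 1) \<times> G \<and> inc s (\<eta>, y). h s) =
    (\<Sum>i\<in>\<eta>. h (\<eta> - {i}, y) + h (\<eta> - {i}, y(i := Suc (y i) mod n i)))"
proof -
  have sub: "\<eta> \<subseteq> {1..q}" and card: "card \<eta> = Suc k" using \<eta> unfolding simplices_of_nat by auto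
  have fin: "finite \<eta>" using sub finite_subset by blast
  define f where "f = (\<lambda>(i, b). (\<eta> - {i}, if b then y else y(i := Suc (y i) mod n i)))"
  have ne: "Suc (y i) mod n i \<noteq> y i" if "i \<in> \<eta>" for i
    using that sub side_lengths[of i] grid_less[OF y, of i] by (intro Suc_mod_neq) auto
  have "{s. s \<in> simplices q (int k - 1) \<times> G \<and> inc s (\<eta>, y)} = f ` (\<eta> \<times> UNIV)"
  proof (intro equalityI subsetI)
    fix s assume "s \<in> {s. s \<in> simplices q (int k - 1) \<times> G \<and> inc s (\<eta>, y)}"
    then obtain i where "i \<in> \<eta>" "s = f (i, True) \<or> s = f (i, False)"
      by (cases s) (auto simp: inc_def f_def)
    thus "s \<in> f ` (\<eta> \<times> UNIV)" by blast
  next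
    fix s assume "s \<in> f ` (\<eta> \<times> UNIV)"
    then obtain i b where i: "i \<in> \<eta>" "s = f (i, b)" by auto
    have "i \<in> {1..q}" using i sub by blast
    hence "snd s \<in> G" using i y fun_upd_grid mod_less_side by (auto simp: f_def)
    moreover have "fst s \<in> simplices q (int k - 1)"
      using i sub fin card unfolding simplices_of_nat by (auto simp: f_def)
    ultimately show "s \<in> {s. s \<in> simplices q (int k - 1) \<times> G \<and> inc s (\<eta>, y)}"
      using i by (cases s) (auto simp: inc_def f_def)
  qed
  moreover have "inj_on f (\<eta> \<times> UNIV)"
  proof (rule inj_onI)
    fix a b assume ab: "a \<in> \<eta> \<times> UNIV" "b \<in> \<eta> \<times> UNIV" "f a = f b"
    obtain i c j e where [simp]: "a = (i, c)" "b = (j, e)" by (metis surj_pair)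
    have "i = j" using ab by (auto simp: f_def)
    with ab ne[of i] show "a = b" by (auto simp: f_def fun_eq_iff split: if_splits)
  qed
  ultimately have "(\<Sum>s | s \<in> simplices q (int k - 1) \<times> G \<and> inc s (\<eta>, y). h s) = (\<Sum>a\<in>\<eta> \<times> UNIV. h (f a))"
    by (simp add: sum.reindex)
  also have "\<dots> = (\<Sum>i\<in>\<eta>. \<Sum>b\<in>UNIV. h (f (i, b)))"
    by (simp add: sum.cartesian_product)
  also have "\<dots> = (\<Sum>i\<in>\<eta>. h (\<eta> - {i}, y) + h (\<eta> - {i}, y(i := Suc (y i) mod n i)))"
    by (simp add: UNIV_bool f_def add.commute)
  finally show ?thesis .
qed

text \<open>For each missing direction the cube is the near face of the coface with the same corner
  and the far face of the one whose corner is a step back.\<close>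

lemma sum_cofaces:
  fixes h :: "_ \<Rightarrow> 'a::comm_monoid_add"
  assumes \<rho>: "\<rho> \<in> simplices q (int k - 1)" and x: "x \<in> G"
  shows "(\<Sum>t | t \<in> simplices q (int (Suc k) - 1) \<times> G \<and> inc (\<rho>, x) t. h t) =
    (\<Sum>i\<in>{1..q} - \<rho>. h (insert i \<rho>, x) + h (insert i \<rho>, x(i := (x i + n i - 1) mod n i)))"
proof -
  have sub: "\<rho> \<subseteq> {1..q}" and card: "card \<rho> = k" using \<rho> unfolding simplices_of_nat by auto
  have fin: "finite \<rho>" using sub finite_subset by blast
  define f where "f = (\<lambda>(i, b). (insert i \<rho>, if b then x else x(i := (x i + n i - 1) mod n i)))"
  have pred: "x i = Suc k mod n i \<longleftrightarrow> k = (x i + n i - 1) mod n i" if "i \<in> {1..q}" "k < n i" for i k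
    using that grid_less[OF x, of i] by (intro pred_mod_eq_iff) auto
  have less: "(x i + n i - 1) mod n i < n i" if "i \<in> {1..q}" for i
    using that by (rule mod_less_side)
  have ne: "(x i + n i - 1) mod n i \<noteq> x i" if "i \<in> {1..q}" for i
    using that pred[OF that grid_less[OF x that]] Suc_mod_neq[OF side_lengths[OF that] grid_less[OF x that]]
    by metis
  have "{t. t \<in> simplices q (int (Suc k) - 1) \<times> G \<and> inc (\<rho>, x) t} = f ` (({1..q} - \<rho>) \<times> UNIV)"
  proof (intro equalityI subsetI)
    fix t assume t: "t \<in> {t. t \<in> simplices q (int (Suc k) - 1) \<times> G \<and> inc (\<rho>, x) t}"
    obtain \<eta> y where [simp]: "t = (\<eta>, y)" by (metis surj_pair)
    obtain i where i: "i \<in> \<eta>" "\<rho> = \<eta> - {i}" "x = y \<or> x = y(i := Suc (y i) mod n i)"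
      using t by (auto simp: inc_def)
    have "i \<in> {1..q} - \<rho>" "y \<in> G" using t i by (auto simp: simplices_def)
    moreover from this i have "t = f (i, True) \<or> t = f (i, False)"
      using pred[of i "y i"] grid_less[of y i] by (auto simp: f_def)
    ultimately show "t \<in> f ` (({1..q} - \<rho>) \<times> UNIV)" by blast
  next
    fix t assume "t \<in> f ` (({1..q} - \<rho>) \<times> UNIV)"
    then obtain i b where i: "i \<in> {1..q}" "i \<notin> \<rho>" "t = f (i, b)" by auto
    have "snd t \<in> G" using i x fun_upd_grid less by (auto simp: f_def)
    moreover have "fst t \<in> simplices q (int (Suc k) - 1)"
      using i sub fin card unfolding simplices_of_nat by (auto simp: f_def)
    moreover have "inc (\<rho>, x) t"
      using i pred[OF i(1) less[OF i(1)]] by (auto simp: inc_def f_def)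
    ultimately show "t \<in> {t. t \<in> simplices q (int (Suc k) - 1) \<times> G \<and> inc (\<rho>, x) t}"
      by (cases t) auto
  qed
  moreover have "inj_on f (({1..q} - \<rho>) \<times> UNIV)"
  proof (rule inj_onI)
    fix a b assume ab: "a \<in> ({1..q} - \<rho>) \<times> UNIV" "b \<in> ({1..q} - \<rho>) \<times> UNIV" "f a = f b"
    obtain i c j e where [simp]: "a = (i, c)" "b = (j, e)" by (metis surj_pair)
    have "i = j" using ab by (auto simp: f_def)
    with ab ne[of i] show "a = b" by (auto simp: f_def fun_eq_iff split: if_splits)
  qed
  ultimately have "(\<Sum>t | t \<in> simplices q (int (Suc k) - 1) \<times> G \<and> inc (\<rho>, x) t. h t) =
      (\<Sum>a\<in>({1..q} - \<rho>) \<times> UNIV. h (f a))"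
    by (simp add: sum.reindex)
  also have "\<dots> = (\<Sum>i\<in>{1..q} - \<rho>. \<Sum>b\<in>UNIV. h (f (i, b)))"
    by (simp add: sum.cartesian_product)
  also have "\<dots> = (\<Sum>i\<in>{1..q} - \<rho>. h (insert i \<rho>, x) + h (insert i \<rho>, x(i := (x i + n i - 1) mod n i)))"
    by (simp add: UNIV_bool f_def add.commute)
  finally show ?thesis .
qed

end

section \<open>Fourier transform of the incidence operators\<close>

text \<open>Similarity invariance with index sets of different types. The hypotheses give
  \<open>A = F D F'\<close>, and Sylvester's identity moves \<open>F\<close> to the other end, where
  \<open>F' F = 1\<close> removes it.\<close>

lemma det_on_intertwine:
  fixes A :: "'i \<Rightarrow> 'i \<Rightarrow> 'a::idom" and D :: "'j \<Rightarrow> 'j \<Rightarrow> 'a"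
  assumes fin: "finite S" "finite T"
    and AF: "\<And>s t. s \<in> S \<Longrightarrow> t \<in> T \<Longrightarrow> (\<Sum>s'\<in>S. A s s' * F s' t) = (\<Sum>t'\<in>T. F s t' * D t' t)"
    and FF': "\<And>s s'. s \<in> S \<Longrightarrow> s' \<in> S \<Longrightarrow> (\<Sum>t\<in>T. F s t * F' t s') = (if s = s' then 1 else 0)"
    and F'F: "\<And>t t'. t \<in> T \<Longrightarrow> t' \<in> T \<Longrightarrow> (\<Sum>s\<in>S. F' t s * F s t') = (if t = t' then 1 else 0)"
  shows "det_on S (\<lambda>s s'. (if s = s' then 1 else 0) - r * A s s') =
    det_on T (\<lambda>t t'. (if t = t' then 1 else 0) - r * D t t')"
proof -
  have "A s s' = (\<Sum>t'\<in>T. F s t' * (\<Sum>t\<in>T. D t' t * F' t s'))" if s: "s \<in> S" "s' \<in> S" for s s'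
  proof -
    have "A s s' = (\<Sum>s''\<in>S. A s s'' * (if s'' = s' then 1 else 0))"
      using fin s by (simp add: if_distrib[of "\<lambda>a. _ * a"] cong: if_cong)
    also have "\<dots> = (\<Sum>s''\<in>S. \<Sum>t\<in>T. A s s'' * F s'' t * F' t s')"
      using s by (intro sum.cong refl) (simp add: FF'[symmetric] sum_distrib_left mult.assoc)
    also have "\<dots> = (\<Sum>t\<in>T. (\<Sum>s''\<in>S. A s s'' * F s'' t) * F' t s')"
      by (subst sum.swap) (simp add: sum_distrib_right)
    also have "\<dots> = (\<Sum>t\<in>T. (\<Sum>t'\<in>T. F s t' * D t' t) * F' t s')"
      using s by (simp add: AF)
    also have "\<dots> = (\<Sum>t'\<in>T. \<Sum>t\<in>T. F s t' * D t' t * F' t s')"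
      unfolding sum_distrib_right by (rule sum.swap)
    also have "\<dots> = (\<Sum>t'\<in>T. F s t' * (\<Sum>t\<in>T. D t' t * F' t s'))"
      by (simp add: sum_distrib_left mult.assoc)
    finally show ?thesis .
  qed
  hence "det_on S (\<lambda>s s'. (if s = s' then 1 else 0) - r * A s s') =
      det_on S (\<lambda>s s'. (if s = s' then 1 else 0) - (\<Sum>t'\<in>T. F s t' * (r * (\<Sum>t\<in>T. D t' t * F' t s'))))"
    by (intro det_on_cong) (simp add: sum_distrib_left mult_ac)
  also have "\<dots> = det_on T (\<lambda>t t'. (if t = t' then 1 else 0) -
      (\<Sum>s\<in>S. (r * (\<Sum>t''\<in>T. D t t'' * F' t'' s)) * F s t'))"
    using fin by (rule det_on_sylvester)
  also have "\<dots> = det_on T (\<lambda>t t'. (if t = t' then 1 else 0) - r * D t t')"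
  proof (rule det_on_cong)
    fix t t' assume t: "t \<in> T" "t' \<in> T"
    have "(\<Sum>s\<in>S. (r * (\<Sum>t''\<in>T. D t t'' * F' t'' s)) * F s t') =
        (\<Sum>s\<in>S. \<Sum>t''\<in>T. r * (D t t'' * (F' t'' s * F s t')))"
      by (simp add: sum_distrib_left sum_distrib_right mult.assoc)
    also have "\<dots> = (\<Sum>t''\<in>T. r * (D t t'' * (\<Sum>s\<in>S. F' t'' s * F s t')))"
      by (subst sum.swap) (simp add: sum_distrib_left)
    also have "\<dots> = (\<Sum>t''\<in>T. r * (D t t'' * (if t'' = t' then 1 else 0)))"
      using t by (simp add: F'F)
    also have "\<dots> = r * D t t'"
      using fin t by (simp add: if_distrib[of "\<lambda>a. _ * a"] cong: if_cong)
    finally show "(if t = t' then 1 else 0) - (\<Sum>s\<in>S. (r * (\<Sum>t''\<in>T. D t t'' * F' t'' s)) * F s t') =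
        (if t = t' then 1 else 0) - r * D t t'" by simp
  qed
  finally show ?thesis .
qed

lemma det_on_Times_diag:
  fixes D :: "'k \<Rightarrow> 'i \<Rightarrow> 'i \<Rightarrow> 'a::idom"
  assumes "finite K" "finite Z"
  shows "det_on (K \<times> Z) (\<lambda>s t. if snd s = snd t then D (snd s) (fst s) (fst t) else 0) =
    (\<Prod>z\<in>Z. det_on K (D z))"
  using assms(2)
proof (induction Z)
  case empty
  show ?case by (simp add: det_on_def)
next
  case (insert z Z)
  let ?M = "\<lambda>s t. if snd s = snd t then D (snd s) (fst s) (fst t) else 0"
  have "det_on (K \<times> insert z Z) ?M = det_on (K \<times> {z} \<union> K \<times> Z) ?M"
    by (rule arg_cong[of _ _ "\<lambda>S. det_on S ?M"]) auto
  also have "\<dots> = det_on (K \<times> {z}) ?M * det_on (K \<times> Z) ?M"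
    using assms(1) insert by (intro det_on_Un) auto
  also have "det_on (K \<times> {z}) ?M = det_on K (D z)"
    using assms(1) by (subst det_on_reindex[of "\<lambda>k. (k, z)" K]) (auto simp: bij_betw_def inj_on_def)
  finally show ?case using insert by simp
qed

text \<open>Multiplication by a primitive root \<open>c\<close> permutes the roots of unity and
  scales the sum by \<open>c^j / c^k\<close>. For \<open>j\<close> and \<open>k\<close> distinct
  below \<open>m\<close> this factor is not 1, so the sum vanishes.\<close>

lemma sum_roots_unity_orthogonal:
  assumes "j < m" "k < (m::nat)"
  shows "(\<Sum>w | w ^ m = 1. w ^ j * inverse (w ^ k)) = (if j = k then of_nat m else (0::complex))"
proof (cases "j = k")
  case True
  have "w ^ j * inverse (w ^ k) = 1" if "w ^ m = 1" for w :: complex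
  proof -
    have "w \<noteq> 0" using that assms by (auto simp: power_0_left)
    thus ?thesis using True by simp
  qed
  hence "(\<Sum>w | w ^ m = 1. w ^ j * inverse (w ^ k)) = (\<Sum>w\<in>{w::complex. w ^ m = 1}. 1 :: complex)"
    by (intro sum.cong) auto
  thus ?thesis using True assms by (simp add: card_roots_unity_eq)
next
  case False
  define c :: complex where "c = cis (2 * pi / real m)"
  have m: "m > 0" using assms by simp
  have c: "c ^ i = cis (2 * pi * real i / real m)" for i
    unfolding c_def Complex.DeMoivre by (rule arg_cong[of _ _ cis]) (simp add: mult_ac)
  have cm: "c ^ m = 1" using m by (simp add: c)
  have c0: "c \<noteq> 0" by (simp add: c_def)
  have "inj_on (\<lambda>k. cis (2 * pi * real k / real m)) {..<m}"
    using Complex.bij_betw_roots_unity[OF m] by (simp add: bij_betw_def)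
  hence "c ^ j \<noteq> c ^ k"
    using assms False by (auto simp: c inj_on_def)
  hence c1: "c ^ j * inverse (c ^ k) \<noteq> 1"
    using c0 by (simp add: field_simps)
  have "bij_betw (\<lambda>w. c * w) {w. w ^ m = 1} {w. w ^ m = 1}"
    using c0 cm by (intro bij_betw_byWitness[where f' = "\<lambda>w. w / c"])
      (auto simp: power_mult_distrib power_divide)
  from sum.reindex_bij_betw[OF this, of "\<lambda>w. w ^ j * inverse (w ^ k)"]
  have "(\<Sum>w | w ^ m = 1. w ^ j * inverse (w ^ k)) =
      c ^ j * inverse (c ^ k) * (\<Sum>w | w ^ m = 1. w ^ j * inverse (w ^ k))"
    by (simp add: power_mult_distrib sum_distrib_left mult_ac)
  with c1 False show ?thesis by simp
qed

lemma sum_powers_roots_unity_orthogonal: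
  assumes "v ^ m = 1" "w ^ m = (1::complex)" "m > 0"
  shows "(\<Sum>k<m. inverse (v ^ k) * w ^ k) = (if v = w then of_nat m else 0)"
proof -
  have v: "v \<noteq> 0" using assms by (auto simp: power_0_left)
  have "(\<Sum>k<m. inverse (v ^ k) * w ^ k) = (\<Sum>k<m. (w / v) ^ k)"
    by (simp add: power_divide field_simps)
  also have "\<dots> = (if v = w then of_nat m else 0)"
  proof (cases "v = w")
    case False
    hence "w / v \<noteq> 1" using v by simp
    moreover have "(w / v) ^ m = 1" using assms by (simp add: power_divide)
    ultimately show ?thesis using False geometric_sum[of "w / v" m] by simp
  qed (use v in simp)
  finally show ?thesis .
qed

text \<open>The character of the translation group attached to \<open>z\<close>, evaluated at the
  grid point \<open>x\<close>.\<close>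

definition chi :: "nat \<Rightarrow> (nat \<Rightarrow> complex) \<Rightarrow> (nat \<Rightarrow> nat) \<Rightarrow> complex" where
  "chi q z x = (\<Prod>i=1..q. z i ^ x i)"

lemma prod_if_zero:
  "finite A \<Longrightarrow> (\<Prod>i\<in>A. if P i then f i else 0 :: 'a::comm_semiring_1) = (if \<forall>i\<in>A. P i then prod f A else 0)"
  by (induction A rule: finite_induct) auto

section \<open>Characters of the translation group and their orthogonality\<close>

context torus
begin

abbreviation "Z \<equiv> torus_characters q n"

lemma finite_characters [simp]: "finite Z"
  using side_lengths by (auto simp: torus_characters_def intro!: finite_PiE finite_roots_unity order_trans[OF _ side_lengths])

lemma card_characters: "card Z = card G"
proof -
  have "card Z = (\<Prod>i=1..q. card {w::complex. w ^ n i = 1})"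
    by (simp add: torus_characters_def card_PiE)
  also have "\<dots> = (\<Prod>i=1..q. n i)"
    using side_lengths by (intro prod.cong refl card_roots_unity_eq) fastforce
  finally show ?thesis by (simp add: grid_def card_PiE)
qed

lemma character_root: "z \<in> Z \<Longrightarrow> i \<in> {1..q} \<Longrightarrow> z i ^ n i = 1"
  by (auto simp: torus_characters_def)

lemma character_nonzero:
  assumes "z \<in> Z" "i \<in> {1..q}"
  shows "z i \<noteq> 0"
proof
  assume "z i = 0"
  with character_root[OF assms] side_lengths[OF assms(2)] show False by (auto simp: power_0_left)
qed

lemma chi_orthogonal_characters:
  assumes "x \<in> G" "x' \<in> G"
  shows "(\<Sum>z\<in>Z. chi q z x * inverse (chi q z x')) = (if x = x' then of_nat (card G) else 0)"
proof -
  have "(\<Sum>z\<in>Z. chi q z x * inverse (chi q z x')) =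
      (\<Sum>z\<in>Z. \<Prod>i\<in>{1..q}. z i ^ x i * inverse (z i ^ x' i))"
    by (simp add: chi_def prod.distrib prod_inversef[symmetric] o_def)
  also have "\<dots> = (\<Prod>i\<in>{1..q}. \<Sum>w | w ^ n i = 1. w ^ x i * inverse (w ^ x' i))"
    unfolding torus_characters_def by (rule prod_sum_PiE[symmetric])
      (use side_lengths in \<open>auto intro!: finite_roots_unity order_trans[OF _ side_lengths]\<close>)
  also have "\<dots> = (\<Prod>i\<in>{1..q}. if x i = x' i then of_nat (n i) else 0)"
    using assms grid_less by (intro prod.cong refl sum_roots_unity_orthogonal) auto
  also have "\<dots> = (if \<forall>i\<in>{1..q}. x i = x' i then \<Prod>i\<in>{1..q}. of_nat (n i) else 0)"
    by (intro prod_if_zero) simp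
  also have "(\<forall>i\<in>{1..q}. x i = x' i) \<longleftrightarrow> x = x'"
    using assms by (auto simp: grid_def intro: PiE_ext)
  finally show ?thesis by (simp add: grid_def card_PiE)
qed

lemma chi_orthogonal_grid:
  assumes "z \<in> Z" "z' \<in> Z"
  shows "(\<Sum>x\<in>G. inverse (chi q z x) * chi q z' x) = (if z = z' then of_nat (card G) else 0)"
proof -
  have "(\<Sum>x\<in>G. inverse (chi q z x) * chi q z' x) =
      (\<Sum>x\<in>G. \<Prod>i\<in>{1..q}. inverse (z i ^ x i) * z' i ^ x i)"
    by (simp add: chi_def prod.distrib prod_inversef[symmetric] o_def)
  also have "\<dots> = (\<Prod>i\<in>{1..q}. \<Sum>k<n i. inverse (z i ^ k) * z' i ^ k)"
    unfolding grid_def by (rule prod_sum_PiE[symmetric]) auto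
  also have "\<dots> = (\<Prod>i\<in>{1..q}. if z i = z' i then of_nat (n i) else 0)"
    using assms character_root side_lengths
    by (intro prod.cong refl sum_powers_roots_unity_orthogonal) fastforce+
  also have "\<dots> = (if \<forall>i\<in>{1..q}. z i = z' i then \<Prod>i\<in>{1..q}. of_nat (n i) else 0)"
    by (intro prod_if_zero) simp
  also have "(\<forall>i\<in>{1..q}. z i = z' i) \<longleftrightarrow> z = z'"
    using assms by (auto simp: torus_characters_def intro: PiE_ext)
  finally show ?thesis by (simp add: grid_def card_PiE)
qed

lemma chi_upd:
  assumes "i \<in> {1..q}"
  shows "chi q z (x(i := k)) = (\<Prod>j\<in>{1..q} - {i}. z j ^ x j) * z i ^ k"
    and "chi q z x = (\<Prod>j\<in>{1..q} - {i}. z j ^ x j) * z i ^ x i"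
  unfolding chi_def using assms by (simp_all add: prod.remove[of _ i] mult.commute)

text \<open>A wrap-around changes the exponent by a multiple of \<open>n i\<close>, which
  \<open>z i\<close> does not see.\<close>

lemma chi_succ:
  assumes "z \<in> Z" "i \<in> {1..q}"
  shows "chi q z (y(i := Suc (y i) mod n i)) = chi q z y * z i"
proof -
  have "z i ^ Suc (y i) = z i ^ (n i * (Suc (y i) div n i) + Suc (y i) mod n i)"
    by simp
  also have "\<dots> = z i ^ (Suc (y i) mod n i)"
    unfolding power_add power_mult using character_root[OF assms] by simp
  finally show ?thesis using chi_upd[OF assms(2), of z y] by (simp add: mult_ac)
qed

lemma chi_pred:
  assumes "z \<in> Z" "i \<in> {1..q}" "x \<in> G"
  shows "chi q z (x(i := (x i + n i - 1) mod n i)) = chi q z x * inverse (z i)"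
proof -
  define y where "y = x(i := (x i + n i - 1) mod n i)"
  have less: "(x i + n i - 1) mod n i < n i" using mod_less_side[OF assms(2)] .
  have "x i = Suc ((x i + n i - 1) mod n i) mod n i"
    using less grid_less[OF assms(3,2)] by (subst pred_mod_eq_iff) auto
  hence "y(i := Suc (y i) mod n i) = x" by (auto simp: y_def)
  with chi_succ[OF assms(1,2), of y] have "chi q z x = chi q z y * z i" by simp
  thus ?thesis using character_nonzero[OF assms(1,2)] by (simp add: y_def)
qed

end

text \<open>Fourier symbol of the sum over cofaces: the term 1 comes from the coface with the same
  corner, the inverse coordinate from the one whose corner is a step back.\<close>

definition B_hat :: "(nat \<Rightarrow> complex) \<Rightarrow> nat set \<Rightarrow> nat set \<Rightarrow> complex" where
  "B_hat z \<rho> \<eta> = (if \<rho> \<subseteq> \<eta> then 1 + inverse (coord z (\<eta> - \<rho>)) else 0)"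

text \<open>Fourier symbol of the transposed operator, the sum over faces: the term 1 is the near
  face, the coordinate is the far face.\<close>

definition C_hat :: "(nat \<Rightarrow> complex) \<Rightarrow> nat set \<Rightarrow> nat set \<Rightarrow> complex" where
  "C_hat z \<eta> \<rho> = (if \<rho> \<subseteq> \<eta> then 1 + coord z (\<eta> - \<rho>) else 0)"

lemma simplices_finite_elem: "\<rho> \<in> simplices q k \<Longrightarrow> finite \<rho>"
  by (auto simp: simplices_def intro: finite_subset)

text \<open>Distinct \<open>\<rho>\<close> and \<open>\<rho>'\<close> of equal size have at most one
  common coface, namely their union, and it has the right size exactly when they differ in one
  element.\<close>

lemma A_up_eq:
  assumes "\<rho> \<in> simplices q (int k - 1)" "\<rho>' \<in> simplices q (int k - 1)"
  shows "A_up q (Suc k) z \<rho> \<rho>' =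
    (\<Sum>\<eta>\<in>simplices q (int (Suc k) - 1). B_hat z \<rho> \<eta> * C_hat z \<eta> \<rho>')"
proof (cases "\<rho> = \<rho>'")
  case True
  show ?thesis unfolding True A_up_def
    by (simp, intro sum.mono_neutral_cong_left) (auto simp: B_hat_def C_hat_def)
next
  case False
  have fin: "finite \<rho>" "finite \<rho>'" using assms simplices_finite_elem by auto
  have card: "card \<rho> = k" "card \<rho>' = k" and sub: "\<rho> \<union> \<rho>' \<subseteq> {1..q}"
    using assms unfolding simplices_of_nat by auto
  have diff: "card (\<rho> - \<rho>') = card (\<rho>' - \<rho>)"
    using card fin by (simp add: card_Diff_subset_Int Int_commute)
  have Un: "card (\<rho> \<union> \<rho>') = k + card (\<rho> - \<rho>')"
    using card fin diff card_Un_disjoint[of \<rho> "\<rho>' - \<rho>"] by simp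
  have pos: "card (\<rho> - \<rho>') > 0"
    using False fin card by (metis Diff_eq_empty_iff card_0_eq card_subset_eq finite_Diff gr0I)
  show ?thesis
  proof (cases "card (\<rho> - \<rho>') = 1")
    case True
    have "(\<Sum>\<eta>\<in>simplices q (int (Suc k) - 1). B_hat z \<rho> \<eta> * C_hat z \<eta> \<rho>') =
        (\<Sum>\<eta>\<in>{\<rho> \<union> \<rho>'}. B_hat z \<rho> \<eta> * C_hat z \<eta> \<rho>')"
    proof (rule sum.mono_neutral_right)
      show "{\<rho> \<union> \<rho>'} \<subseteq> simplices q (int (Suc k) - 1)"
        using sub Un True unfolding simplices_of_nat by simp
      show "\<forall>\<eta>\<in>simplices q (int (Suc k) - 1) - {\<rho> \<union> \<rho>'}. B_hat z \<rho> \<eta> * C_hat z \<eta> \<rho>' = 0"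
      proof
        fix \<eta> assume \<eta>: "\<eta> \<in> simplices q (int (Suc k) - 1) - {\<rho> \<union> \<rho>'}"
        have "\<not> \<rho> \<union> \<rho>' \<subseteq> \<eta>"
        proof
          assume "\<rho> \<union> \<rho>' \<subseteq> \<eta>"
          moreover have "finite \<eta>" "card \<eta> = Suc k"
            using \<eta> simplices_finite_elem unfolding simplices_of_nat by (auto intro: finite_subset)
          ultimately have "\<rho> \<union> \<rho>' = \<eta>" using Un True by (intro card_subset_eq) auto
          with \<eta> show False by simp
        qed
        thus "B_hat z \<rho> \<eta> * C_hat z \<eta> \<rho>' = 0" by (auto simp: B_hat_def C_hat_def)
      qed
    qed simp
    moreover have "\<rho> \<union> \<rho>' - \<rho> = \<rho>' - \<rho>" "\<rho> \<union> \<rho>' - \<rho>' = \<rho> - \<rho>'" by auto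
    ultimately show ?thesis
      using False True by (simp add: A_up_def B_hat_def C_hat_def)
  next
    case not1: False
    have "B_hat z \<rho> \<eta> * C_hat z \<eta> \<rho>' = 0" if "\<eta> \<in> simplices q (int (Suc k) - 1)" for \<eta>
    proof -
      have "finite \<eta>" "card \<eta> = Suc k"
        using that simplices_finite_elem unfolding simplices_of_nat by (auto intro: finite_subset)
      hence "\<not> \<rho> \<union> \<rho>' \<subseteq> \<eta>"
        using card_mono[of \<eta> "\<rho> \<union> \<rho>'"] Un pos not1 by linarith
      thus ?thesis by (auto simp: B_hat_def C_hat_def)
    qed
    thus ?thesis using False not1 by (simp add: A_up_def)
  qed
qed

text \<open>Dual to \<open>A_up_eq\<close>, with the factors in the opposite order: the only
  possible common face of distinct simplices is their intersection.\<close>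

lemma A_down_eq:
  assumes "\<eta> \<in> simplices q (int (Suc k) - 1)" "\<eta>' \<in> simplices q (int (Suc k) - 1)"
  shows "A_down q (Suc k) z \<eta> \<eta>' =
    (\<Sum>\<rho>\<in>simplices q (int k - 1). C_hat z \<eta> \<rho> * B_hat z \<rho> \<eta>')"
proof (cases "\<eta> = \<eta>'")
  case True
  have "int (Suc k) - 2 = int k - 1" by simp
  thus ?thesis unfolding True A_down_def
    by (simp, intro sum.mono_neutral_cong_left) (auto simp: B_hat_def C_hat_def)
next
  case False
  have fin: "finite \<eta>" "finite \<eta>'" using assms simplices_finite_elem by auto
  have card: "card \<eta> = Suc k" "card \<eta>' = Suc k" and sub: "\<eta> \<inter> \<eta>' \<subseteq> {1..q}"
    using assms unfolding simplices_of_nat by auto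
  have Int: "card (\<eta> \<inter> \<eta>') + card (\<eta> - \<eta>') = Suc k"
    using card fin by (metis card_Diff_subset_Int card_mono finite_Int inf_le1 le_add_diff_inverse)
  have pos: "card (\<eta> - \<eta>') > 0"
    using False fin card by (metis Diff_eq_empty_iff card_0_eq card_subset_eq finite_Diff gr0I)
  show ?thesis
  proof (cases "card (\<eta> - \<eta>') = 1")
    case True
    have "(\<Sum>\<rho>\<in>simplices q (int k - 1). C_hat z \<eta> \<rho> * B_hat z \<rho> \<eta>') =
        (\<Sum>\<rho>\<in>{\<eta> \<inter> \<eta>'}. C_hat z \<eta> \<rho> * B_hat z \<rho> \<eta>')"
    proof (rule sum.mono_neutral_right)
      show "{\<eta> \<inter> \<eta>'} \<subseteq> simplices q (int k - 1)"
        using sub Int True unfolding simplices_of_nat by simp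
      show "\<forall>\<rho>\<in>simplices q (int k - 1) - {\<eta> \<inter> \<eta>'}. C_hat z \<eta> \<rho> * B_hat z \<rho> \<eta>' = 0"
      proof
        fix \<rho> assume \<rho>: "\<rho> \<in> simplices q (int k - 1) - {\<eta> \<inter> \<eta>'}"
        have "\<not> \<rho> \<subseteq> \<eta> \<inter> \<eta>'"
        proof
          assume "\<rho> \<subseteq> \<eta> \<inter> \<eta>'"
          moreover have "card \<rho> = k" using \<rho> unfolding simplices_of_nat by auto
          ultimately have "\<rho> = \<eta> \<inter> \<eta>'" using Int True fin by (intro card_subset_eq) auto
          with \<rho> show False by simp
        qed
        thus "C_hat z \<eta> \<rho> * B_hat z \<rho> \<eta>' = 0" by (auto simp: B_hat_def C_hat_def)
      qed
    qed simp
    moreover have "\<eta> - \<eta> \<inter> \<eta>' = \<eta> - \<eta>'" "\<eta>' - \<eta> \<inter> \<eta>' = \<eta>' - \<eta>" by auto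
    ultimately show ?thesis
      using False True by (simp add: A_down_def B_hat_def C_hat_def)
  next
    case not1: False
    have "C_hat z \<eta> \<rho> * B_hat z \<rho> \<eta>' = 0" if "\<rho> \<in> simplices q (int k - 1)" for \<rho>
    proof -
      have "card \<rho> = k" using that unfolding simplices_of_nat by auto
      hence "\<not> \<rho> \<subseteq> \<eta> \<inter> \<eta>'"
        using card_mono[of "\<eta> \<inter> \<eta>'" \<rho>] fin Int pos not1 by auto
      thus ?thesis by (auto simp: B_hat_def C_hat_def)
    qed
    thus ?thesis using False not1 by (simp add: A_down_def)
  qed
qed

text \<open>At most one direction can be removed from \<open>\<eta>\<close> to give
  \<open>\<rho>\<close>, so the sum over directions collapses to one symbol entry.\<close>

lemma sum_C_hat:
  assumes "\<eta> \<in> simplices q (int (Suc k) - 1)" "\<rho> \<in> simplices q (int k - 1)"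
  shows "(\<Sum>i\<in>\<eta>. if \<eta> - {i} = \<rho> then 1 + z i else 0) = C_hat z \<eta> \<rho>"
proof (cases "\<rho> \<subseteq> \<eta>")
  case True
  have fin: "finite \<eta>" "finite \<rho>" using assms simplices_finite_elem by auto
  have "card \<rho> = k" "card \<eta> = Suc k"
    using assms unfolding simplices_of_nat by auto
  hence "card (\<eta> - \<rho>) = 1" using True fin by (simp add: card_Diff_subset)
  then obtain i where i: "\<eta> - \<rho> = {i}" by (rule card_1_singletonE)
  have "(\<Sum>j\<in>\<eta>. if \<eta> - {j} = \<rho> then 1 + z j else 0) = (\<Sum>j\<in>\<eta>. if j = i then 1 + z i else 0)"
    using i True by (intro sum.cong) auto
  also have "\<dots> = C_hat z \<eta> \<rho>"
    using i True fin by (auto simp: C_hat_def coord_def)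
  finally show ?thesis .
qed (auto simp: C_hat_def intro!: sum.neutral)

lemma sum_B_hat:
  assumes "\<rho> \<in> simplices q (int k - 1)"
  shows "(\<Sum>\<eta>\<in>simplices q (int (Suc k) - 1). B_hat z \<rho> \<eta> * h \<eta>) =
    (\<Sum>i\<in>{1..q} - \<rho>. (1 + inverse (z i)) * h (insert i \<rho>))"
proof -
  have fin: "finite \<rho>" using assms simplices_finite_elem by auto
  have \<rho>: "\<rho> \<subseteq> {1..q}" "card \<rho> = k"
    using assms unfolding simplices_of_nat by auto
  have "(\<Sum>\<eta>\<in>simplices q (int (Suc k) - 1). B_hat z \<rho> \<eta> * h \<eta>) =
      (\<Sum>\<eta>\<in>(\<lambda>i. insert i \<rho>) ` ({1..q} - \<rho>). B_hat z \<rho> \<eta> * h \<eta>)"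
  proof (rule sum.mono_neutral_right)
    show "(\<lambda>i. insert i \<rho>) ` ({1..q} - \<rho>) \<subseteq> simplices q (int (Suc k) - 1)"
      using \<rho> fin unfolding simplices_of_nat by auto
    show "\<forall>\<eta>\<in>simplices q (int (Suc k) - 1) - (\<lambda>i. insert i \<rho>) ` ({1..q} - \<rho>). B_hat z \<rho> \<eta> * h \<eta> = 0"
    proof
      fix \<eta> assume \<eta>: "\<eta> \<in> simplices q (int (Suc k) - 1) - (\<lambda>i. insert i \<rho>) ` ({1..q} - \<rho>)"
      have "\<not> \<rho> \<subseteq> \<eta>"
      proof
        assume sub: "\<rho> \<subseteq> \<eta>"
        have "\<eta> \<subseteq> {1..q}" "card \<eta> = Suc k" using \<eta> unfolding simplices_of_nat by auto
        with sub \<rho> fin have "card (\<eta> - \<rho>) = 1" by (simp add: card_Diff_subset)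
        then obtain i where i: "\<eta> - \<rho> = {i}" by (rule card_1_singletonE)
        hence "\<eta> = insert i \<rho>" "i \<in> {1..q} - \<rho>" using sub \<open>\<eta> \<subseteq> {1..q}\<close> by auto
        with \<eta> show False by blast
      qed
      thus "B_hat z \<rho> \<eta> * h \<eta> = 0" by (simp add: B_hat_def)
    qed
  qed simp
  also have "\<dots> = (\<Sum>i\<in>{1..q} - \<rho>. B_hat z \<rho> (insert i \<rho>) * h (insert i \<rho>))"
    by (subst sum.reindex) (auto simp: inj_on_def)
  also have "\<dots> = (\<Sum>i\<in>{1..q} - \<rho>. (1 + inverse (z i)) * h (insert i \<rho>))"
  proof (intro sum.cong refl)
    fix i assume "i \<in> {1..q} - \<rho>"
    hence "insert i \<rho> - \<rho> = {i}" by auto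
    thus "B_hat z \<rho> (insert i \<rho>) * h (insert i \<rho>) = (1 + inverse (z i)) * h (insert i \<rho>)"
      by (auto simp: B_hat_def coord_def)
  qed
  finally show ?thesis .
qed

section \<open>Diagonalisation of the incidence operator by characters\<close>

context torus
begin

text \<open>The incidence operator commutes with translations, so it sends the character
  \<open>z\<close> on cubes of type \<open>\<rho>'\<close> to multiples of the same character on
  every type. Summing over faces produces \<open>C_hat\<close>, then summing over cofaces produces
  \<open>B_hat\<close>.\<close>

lemma up_intertwine:
  assumes \<rho>: "\<rho> \<in> simplices q (int k - 1)" "\<rho>' \<in> simplices q (int k - 1)" and x: "x \<in> G" and z: "z \<in> Z"
  shows "(\<Sum>s'\<in>simplices q (int k - 1) \<times> G.
      (\<Sum>t\<in>simplices q (int (Suc k) - 1) \<times> G. of_bool (inc (\<rho>, x) t) * of_bool (inc s' t)) *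
      (if fst s' = \<rho>' then chi q z (snd s') else 0)) = chi q z x * A_up q (Suc k) z \<rho> \<rho>'"
proof -
  let ?S = "simplices q (int k - 1) \<times> G" and ?T = "simplices q (int (Suc k) - 1) \<times> G"
  define F where "F s = (if fst s = \<rho>' then chi q z (snd s) else 0)" for s :: "nat set \<times> (nat \<Rightarrow> nat)"
  have inner: "(\<Sum>s'\<in>?S. of_bool (inc s' t) * F s') = chi q z (snd t) * C_hat z (fst t) \<rho>'"
    if t: "t \<in> ?T" for t
  proof -
    obtain \<eta> y where ty [simp]: "t = (\<eta>, y)" by (metis surj_pair)
    have \<eta>: "\<eta> \<in> simplices q (int (Suc k) - 1)" and y: "y \<in> G" using t by auto
    have "(\<Sum>s'\<in>?S. of_bool (inc s' t) * F s') = (\<Sum>s' | s' \<in> ?S \<and> inc s' (\<eta>, y). F s')"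
      by (intro sum.mono_neutral_cong_right) auto
    also have "\<dots> = (\<Sum>i\<in>\<eta>. F (\<eta> - {i}, y) + F (\<eta> - {i}, y(i := Suc (y i) mod n i)))"
      using \<eta> y by (rule sum_faces)
    also have "\<dots> = (\<Sum>i\<in>\<eta>. chi q z y * (if \<eta> - {i} = \<rho>' then 1 + z i else 0))"
    proof (intro sum.cong refl)
      fix i assume "i \<in> \<eta>"
      hence "i \<in> {1..q}" using \<eta> by (auto simp: simplices_def)
      thus "F (\<eta> - {i}, y) + F (\<eta> - {i}, y(i := Suc (y i) mod n i)) =
          chi q z y * (if \<eta> - {i} = \<rho>' then 1 + z i else 0)"
        using chi_succ[OF z] by (simp add: F_def ring_distribs)
    qed
    also have "\<dots> = chi q z y * C_hat z \<eta> \<rho>'"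
      by (simp only: sum_distrib_left[symmetric] sum_C_hat[OF \<eta> \<rho>(2)])
    finally show ?thesis by simp
  qed
  have "(\<Sum>s'\<in>?S. (\<Sum>t\<in>?T. of_bool (inc (\<rho>, x) t) * of_bool (inc s' t)) * F s') =
      (\<Sum>t\<in>?T. of_bool (inc (\<rho>, x) t) * (\<Sum>s'\<in>?S. of_bool (inc s' t) * F s'))"
    unfolding sum_distrib_right sum_distrib_left mult.assoc by (rule sum.swap)
  also have "\<dots> = (\<Sum>t\<in>?T. of_bool (inc (\<rho>, x) t) * (chi q z (snd t) * C_hat z (fst t) \<rho>'))"
    by (simp only: inner cong: sum.cong)
  also have "\<dots> = (\<Sum>t | t \<in> ?T \<and> inc (\<rho>, x) t. chi q z (snd t) * C_hat z (fst t) \<rho>')"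
    by (intro sum.mono_neutral_cong_right) auto
  also have "\<dots> = (\<Sum>i\<in>{1..q} - \<rho>. chi q z x * C_hat z (insert i \<rho>) \<rho>' +
      chi q z (x(i := (x i + n i - 1) mod n i)) * C_hat z (insert i \<rho>) \<rho>')"
    using sum_cofaces[OF \<rho>(1) x, of "\<lambda>t. chi q z (snd t) * C_hat z (fst t) \<rho>'"] by simp
  also have "\<dots> = (\<Sum>i\<in>{1..q} - \<rho>. chi q z x * ((1 + inverse (z i)) * C_hat z (insert i \<rho>) \<rho>'))"
    using chi_pred[OF z _ x] by (intro sum.cong refl) (simp add: ring_distribs)
  also have "\<dots> = chi q z x * A_up q (Suc k) z \<rho> \<rho>'"
    by (simp only: sum_distrib_left[symmetric] A_up_eq[OF \<rho>] sum_B_hat[OF \<rho>(1)])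
  finally show ?thesis by (simp add: F_def)
qed

text \<open>In the basis of characters on cubes of a fixed type, the operator is block diagonal with
  blocks \<open>A_up\<close> indexed by \<open>z\<close>. The constant \<open>c\<close> is divided
  out to reach the form \<open>1 - r A\<close> of \<open>det_on_intertwine\<close>.\<close>

lemma det_on_grid_eq_prod:
  assumes c: "c \<noteq> (0 :: complex)"
  shows "det_on (simplices q (int k - 1) \<times> G) (\<lambda>s s'. (if s = s' then c else 0) -
      u * (\<Sum>t\<in>simplices q (int (Suc k) - 1) \<times> G. of_bool (inc s t) * of_bool (inc s' t))) =
    (\<Prod>z\<in>Z. det_on (simplices q (int k - 1)) (\<lambda>\<rho> \<rho>'. c * id_mat \<rho> \<rho>' - u * A_up q (Suc k) z \<rho> \<rho>'))"
proof -
  define K where "K = simplices q (int k - 1)"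
  have finK: "finite K" by (simp add: K_def)
  define A :: "_ \<Rightarrow> _ \<Rightarrow> complex" where
    "A s s' = (\<Sum>t\<in>simplices q (int (Suc k) - 1) \<times> G. of_bool (inc s t) * of_bool (inc s' t))" for s s'
  define D where "D t t' = (if snd t = snd t' then A_up q (Suc k) (snd t) (fst t) (fst t') else 0)"
    for t t' :: "nat set \<times> (nat \<Rightarrow> complex)"
  \<comment> \<open>\<open>F\<close> is the Fourier transform, applied to each type separately;
    \<open>F'\<close> below is its inverse, with the normalisation
    \<open>1 / card G\<close>.\<close>
  define F where "F s t = (if fst s = fst t then chi q (snd t) (snd s) else 0)"
    for s :: "nat set \<times> (nat \<Rightarrow> nat)" and t :: "nat set \<times> (nat \<Rightarrow> complex)"
  define F' where "F' t s = (if fst s = fst t then inverse (chi q (snd t) (snd s)) / of_nat (card G) else 0)"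
    for s :: "nat set \<times> (nat \<Rightarrow> nat)" and t :: "nat set \<times> (nat \<Rightarrow> complex)"
  have G: "card G \<noteq> 0"
  proof -
    have "n i \<noteq> 0" if "i \<in> {1..q}" for i
      using side_lengths[OF that] by linarith
    thus ?thesis by (simp add: grid_def card_PiE)
  qed
  have sum_fst: "(\<Sum>t\<in>K \<times> H. if fst t = \<rho> then h (snd t) else 0) = (\<Sum>z\<in>H. h z)"
    if "\<rho> \<in> K" for \<rho> and H :: "'h set" and h :: "'h \<Rightarrow> complex"
  proof -
    have "(\<Sum>t\<in>K \<times> H. if fst t = \<rho> then h (snd t) else 0) = (\<Sum>\<rho>'\<in>K. \<Sum>z\<in>H. if \<rho>' = \<rho> then h z else 0)"
      by (simp add: sum.cartesian_product case_prod_unfold)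
    also have "\<dots> = (\<Sum>\<rho>'\<in>K. if \<rho>' = \<rho> then \<Sum>z\<in>H. h z else 0)"
      by (intro sum.cong) auto
    finally show ?thesis using that finK by simp
  qed
  have "det_on (K \<times> G) (\<lambda>s s'. (if s = s' then c else 0) - u * A s s') =
      det_on (K \<times> G) (\<lambda>s s'. c * ((if s = s' then 1 else 0) - (u / c) * A s s'))"
    using c by (intro det_on_cong) (simp add: right_diff_distrib)
  also have "\<dots> = c ^ card (K \<times> G) * det_on (K \<times> G) (\<lambda>s s'. (if s = s' then 1 else 0) - (u / c) * A s s')"
    by (rule det_on_scale)
  also have "det_on (K \<times> G) (\<lambda>s s'. (if s = s' then 1 else 0) - (u / c) * A s s') =
      det_on (K \<times> Z) (\<lambda>t t'. (if t = t' then 1 else 0) - (u / c) * D t t')"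
  proof (rule det_on_intertwine[where F = F and F' = F'])
    fix s t assume "s \<in> K \<times> G" "t \<in> K \<times> Z"
    then obtain \<rho> x \<rho>' z where st [simp]: "s = (\<rho>, x)" "t = (\<rho>', z)"
      and *: "\<rho> \<in> K" "\<rho>' \<in> K" "x \<in> G" "z \<in> Z" by auto
    have "(\<Sum>s'\<in>K \<times> G. A s s' * F s' t) = chi q z x * A_up q (Suc k) z \<rho> \<rho>'"
      using up_intertwine[of \<rho> k \<rho>' x z] * by (simp only: A_def F_def K_def st fst_conv snd_conv)
    also have "\<dots> = (\<Sum>z'\<in>Z. if z' = z then chi q z x * A_up q (Suc k) z \<rho> \<rho>' else 0)"
      using * by simp
    also have "\<dots> = (\<Sum>t'\<in>K \<times> Z. if fst t' = \<rho> then if snd t' = z then chi q z x * A_up q (Suc k) z \<rho> \<rho>' else 0 else 0)"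
      using sum_fst[OF *(1), of "\<lambda>z'. if z' = z then chi q z x * A_up q (Suc k) z \<rho> \<rho>' else 0" Z] by simp
    also have "\<dots> = (\<Sum>t'\<in>K \<times> Z. F s t' * D t' t)"
      by (intro sum.cong) (auto simp: F_def D_def)
    finally show "(\<Sum>s'\<in>K \<times> G. A s s' * F s' t) = (\<Sum>t'\<in>K \<times> Z. F s t' * D t' t)" .
  next
    fix s s' assume "s \<in> K \<times> G" "s' \<in> K \<times> G"
    then obtain \<rho> x \<rho>' x' where [simp]: "s = (\<rho>, x)" "s' = (\<rho>', x')"
      and *: "\<rho> \<in> K" "\<rho>' \<in> K" "x \<in> G" "x' \<in> G" by auto
    have "(\<Sum>t\<in>K \<times> Z. F s t * F' t s') =
        (\<Sum>t\<in>K \<times> Z. if fst t = \<rho> then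
          (if \<rho> = \<rho>' then chi q (snd t) x * inverse (chi q (snd t) x') / of_nat (card G) else 0) else 0)"
      by (intro sum.cong) (auto simp: F_def F'_def)
    also have "\<dots> = (\<Sum>z\<in>Z. if \<rho> = \<rho>' then chi q z x * inverse (chi q z x') / of_nat (card G) else 0)"
      using sum_fst[OF *(1), of "\<lambda>z. if \<rho> = \<rho>' then chi q z x * inverse (chi q z x') / of_nat (card G) else 0" Z] by simp
    also have "\<dots> = (if s = s' then 1 else 0)"
      using G chi_orthogonal_characters[OF *(3,4)]
      by (cases "\<rho> = \<rho>'") (simp_all add: sum_divide_distrib[symmetric])
    finally show "(\<Sum>t\<in>K \<times> Z. F s t * F' t s') = (if s = s' then 1 else 0)" .
  next
    fix t t' assume "t \<in> K \<times> Z" "t' \<in> K \<times> Z"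
    then obtain \<rho> z \<rho>' z' where [simp]: "t = (\<rho>, z)" "t' = (\<rho>', z')"
      and *: "\<rho> \<in> K" "\<rho>' \<in> K" "z \<in> Z" "z' \<in> Z" by auto
    have "(\<Sum>s\<in>K \<times> G. F' t s * F s t') =
        (\<Sum>s\<in>K \<times> G. if fst s = \<rho> then
          (if \<rho> = \<rho>' then inverse (chi q z (snd s)) * chi q z' (snd s) / of_nat (card G) else 0) else 0)"
      by (intro sum.cong) (auto simp: F_def F'_def)
    also have "\<dots> = (\<Sum>x\<in>G. if \<rho> = \<rho>' then inverse (chi q z x) * chi q z' x / of_nat (card G) else 0)"
      using sum_fst[OF *(1), of "\<lambda>x. if \<rho> = \<rho>' then inverse (chi q z x) * chi q z' x / of_nat (card G) else 0" G] by simp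
    also have "\<dots> = (if t = t' then 1 else 0)"
      using G chi_orthogonal_grid[OF *(3,4)]
      by (cases "\<rho> = \<rho>'") (simp_all add: sum_divide_distrib[symmetric])
    finally show "(\<Sum>s\<in>K \<times> G. F' t s * F s t') = (if t = t' then 1 else 0)" .
  qed (simp_all add: finK)
  \<comment> \<open>There are as many characters as grid points, so the power of \<open>c\<close>
    taken out on \<open>K \<times> G\<close> fits back into the determinant over
    \<open>K \<times> Z\<close>.\<close>
  also have "c ^ card (K \<times> G) * \<dots> =
      det_on (K \<times> Z) (\<lambda>t t'. c * ((if t = t' then 1 else 0) - (u / c) * D t t'))"
    by (simp only: det_on_scale card_cartesian_product card_characters)
  also have "\<dots> = det_on (K \<times> Z) (\<lambda>t t'. if snd t = snd t' then
      c * id_mat (fst t) (fst t') - u * A_up q (Suc k) (snd t) (fst t) (fst t') else 0)"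
    using c by (intro det_on_cong) (auto simp: id_mat_def D_def prod_eq_iff right_diff_distrib)
  also have "\<dots> = (\<Prod>z\<in>Z. det_on K (\<lambda>\<rho> \<rho>'. c * id_mat \<rho> \<rho>' - u * A_up q (Suc k) z \<rho> \<rho>'))"
    using finK by (intro det_on_Times_diag) simp_all
  finally show ?thesis by (simp only: A_def K_def)
qed

end

text \<open>\<open>A_up\<close> and \<open>A_down\<close> are the two products \<open>B C\<close>
  and \<open>C B\<close> of the same symbols. Sylvester's identity compares them after division by
  \<open>c\<close>, and the different matrix sizes leave a power of \<open>c\<close>.\<close>

lemma det_on_A_down:
  assumes c: "c \<noteq> (0 :: complex)"
  shows "det_on (simplices q (int (Suc k) - 1)) (\<lambda>\<eta> \<eta>'. c * id_mat \<eta> \<eta>' - u * A_down q (Suc k) z \<eta> \<eta>') =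
    c powi (int (q choose Suc k) - int (q choose k)) *
    det_on (simplices q (int k - 1)) (\<lambda>\<rho> \<rho>'. c * id_mat \<rho> \<rho>' - u * A_up q (Suc k) z \<rho> \<rho>')"
proof -
  define K K' where "K = simplices q (int k - 1)" and "K' = simplices q (int (Suc k) - 1)"
  have card: "card K = q choose k" "card K' = q choose Suc k"
    by (simp_all only: K_def K'_def card_simplices)
  have "det_on K' (\<lambda>\<eta> \<eta>'. c * id_mat \<eta> \<eta>' - u * A_down q (Suc k) z \<eta> \<eta>') =
      det_on K' (\<lambda>\<eta> \<eta>'. c * ((if \<eta> = \<eta>' then 1 else 0) -
        (\<Sum>\<rho>\<in>K. C_hat z \<eta> \<rho> * (u / c * B_hat z \<rho> \<eta>'))))"
    using c by (intro det_on_cong)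
      (simp add: A_down_eq K_def K'_def id_mat_def right_diff_distrib sum_distrib_left mult_ac)
  also have "\<dots> = c ^ card K' * det_on K (\<lambda>\<rho> \<rho>'. (if \<rho> = \<rho>' then 1 else 0) -
        (\<Sum>\<eta>\<in>K'. u / c * B_hat z \<rho> \<eta> * C_hat z \<eta> \<rho>'))"
    unfolding det_on_scale by (subst det_on_sylvester) (simp_all add: K_def K'_def)
  also have "c ^ card K' = c powi (int (q choose Suc k) - int (q choose k)) * c ^ card K"
    using c by (simp add: card power_int_diff)
  also have "\<dots> * det_on K (\<lambda>\<rho> \<rho>'. (if \<rho> = \<rho>' then 1 else 0) -
        (\<Sum>\<eta>\<in>K'. u / c * B_hat z \<rho> \<eta> * C_hat z \<eta> \<rho>')) =
      c powi (int (q choose Suc k) - int (q choose k)) *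
      det_on K (\<lambda>\<rho> \<rho>'. c * ((if \<rho> = \<rho>' then 1 else 0) -
        (\<Sum>\<eta>\<in>K'. u / c * B_hat z \<rho> \<eta> * C_hat z \<eta> \<rho>')))"
    by (simp only: det_on_scale mult.assoc)
  also have "det_on K (\<lambda>\<rho> \<rho>'. c * ((if \<rho> = \<rho>' then 1 else 0) -
        (\<Sum>\<eta>\<in>K'. u / c * B_hat z \<rho> \<eta> * C_hat z \<eta> \<rho>'))) =
      det_on K (\<lambda>\<rho> \<rho>'. c * id_mat \<rho> \<rho>' - u * A_up q (Suc k) z \<rho> \<rho>')"
    using c by (intro det_on_cong)
      (simp add: A_up_eq K_def K'_def id_mat_def right_diff_distrib sum_distrib_left mult_ac)
  finally show ?thesis by (simp only: K_def K'_def)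
qed

section \<open>The zeta function of the cubical lattice\<close>

definition flags :: "nat \<Rightarrow> (nat \<Rightarrow> nat) \<Rightarrow> nat \<Rightarrow> ((nat \<Rightarrow> real) set \<times> (nat \<Rightarrow> real) set) set" where
  "flags q n d = {(\<tau>, \<sigma>). \<tau> \<in> cubes q n (d - 1) \<and> \<sigma> \<in> cubes q n d \<and> \<tau> \<subseteq> \<sigma>}"

definition step :: "'a set \<times> 'a set \<Rightarrow> 'a set \<times> 'a set \<Rightarrow> bool" where
  "step f f' \<longleftrightarrow> fst f' \<subseteq> snd f \<and> fst f \<noteq> fst f' \<and> snd f \<noteq> snd f'"

text \<open>The path condition places each lower cube inside its own upper cube only through the
  preceding index: the condition at \<open>i - 1\<close> is what makes the pair at \<open>i\<close>
  a flag.\<close>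

lemma closed_geodesic_iff_closed_word:
  "closed_geodesic q n d g \<longleftrightarrow> closed_word (flags q n d) step g"
proof
  assume g: "closed_geodesic q n d g"
  hence ne: "g \<noteq> []" by (simp add: closed_geodesic_def closed_path_def)
  have *: "fst (g ! i) \<in> cubes q n (d - 1) \<and> snd (g ! i) \<in> cubes q n d \<and>
      fst (g ! i) \<noteq> fst (g ! (Suc i mod length g)) \<and> snd (g ! i) \<noteq> snd (g ! (Suc i mod length g)) \<and>
      fst (g ! (Suc i mod length g)) \<subseteq> snd (g ! i) \<inter> snd (g ! (Suc i mod length g))"
    if "i < length g" for i
    using g that by (simp add: closed_geodesic_def closed_path_def case_prod_unfold Let_def)
  have "g ! i \<in> flags q n d" if i: "i < length g" for i
  proof -
    \<comment> \<open>The cyclic predecessor of \<open>i\<close>, whose path condition supplies the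
      inclusion at \<open>i\<close>.\<close>
    define j where "j = (i + length g - 1) mod length g"
    have j: "j < length g" using ne by (simp add: j_def)
    have "i = Suc j mod length g"
      using pred_mod_eq_iff[OF j i] by (simp add: j_def)
    with *[OF j] *[OF i] show ?thesis by (auto simp: flags_def case_prod_unfold)
  qed
  hence "set g \<subseteq> flags q n d" by (metis in_set_conv_nth subsetI)
  with ne * show "closed_word (flags q n d) step g"
    by (simp add: closed_word_def step_def)
next
  assume g: "closed_word (flags q n d) step g"
  hence ne: "g \<noteq> []" by (simp add: closed_word_def)
  have fl: "g ! i \<in> flags q n d" if "i < length g" for i
    using g that by (auto simp: closed_word_def)
  have "Suc i mod length g < length g" for i using ne by simp
  with g fl show "closed_geodesic q n d g"
    by (fastforce simp: closed_geodesic_def closed_path_def closed_word_def step_def flags_def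
        case_prod_unfold Let_def)
qed

lemma prime_geodesic_iff_prime_word:
  "prime_geodesic q n d g \<longleftrightarrow> prime_word (flags q n d) step g"
  by (simp add: prime_geodesic_def prime_word_def closed_geodesic_iff_closed_word)

lemma prime_cycles_eq:
  "prime_cycles q n d = Collect (prime_word (flags q n d) step) // rotation"
  unfolding prime_cycles_def rotation_def
  by (rule arg_cong2[of _ _ _ _ "(//)"]) (auto simp: prime_geodesic_iff_prime_word)

section \<open>Degrees of the incidence graph and the two determinant formulas\<close>

context torus
begin

lemma finite_cubes: "finite (cubes q n k)"
  by (simp add: cubes_eq)

lemma sum_cubes:
  "(\<Sum>c\<in>cubes q n k. h c) = (\<Sum>s\<in>simplices q (int k - 1) \<times> G. h (cube q n s))"
  by (rule sum.reindex_bij_betw[OF bij_betw_cube, symmetric])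

text \<open>Two faces per direction, from \<open>sum_faces\<close> with weight 1. For
  \<open>d = Suc k\<close> this is \<open>beta d + 1\<close>.\<close>

lemma card_faces:
  assumes "\<sigma> \<in> cubes q n (Suc k)"
  shows "card {\<tau>\<in>cubes q n k. \<tau> \<subseteq> \<sigma>} = 2 * Suc k"
proof -
  obtain \<eta> y where \<sigma>: "\<sigma> = cube q n (\<eta>, y)" and \<eta>: "\<eta> \<in> simplices q (int (Suc k) - 1)" and y: "y \<in> G"
    using assms by (auto simp: cubes_eq)
  have "card {\<tau>\<in>cubes q n k. \<tau> \<subseteq> \<sigma>} = (\<Sum>\<tau>\<in>cubes q n k. if \<tau> \<subseteq> \<sigma> then 1 else 0)"
    using finite_cubes by (simp add: sum.inter_filter[symmetric])
  also have "\<dots> = (\<Sum>s\<in>simplices q (int k - 1) \<times> G. if inc s (\<eta>, y) then 1 else 0)"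
    unfolding sum_cubes \<sigma> using \<eta> y cube_subset_iff_inc[of _ k "(\<eta>, y)"]
    by (intro sum.cong refl) simp
  also have "\<dots> = (\<Sum>s | s \<in> simplices q (int k - 1) \<times> G \<and> inc s (\<eta>, y). 1)"
    by (intro sum.inter_filter[symmetric]) simp
  also have "\<dots> = (\<Sum>i\<in>\<eta>. 1 + 1)"
    using \<eta> y by (rule sum_faces)
  also have "\<dots> = 2 * Suc k"
    using \<eta> unfolding simplices_of_nat by simp
  finally show ?thesis .
qed

text \<open>Two cofaces per missing direction. For \<open>d = Suc k\<close> this is
  \<open>alpha q d + 1\<close> when \<open>d \<le> q\<close>.\<close>

lemma card_cofaces:
  assumes "\<tau> \<in> cubes q n k"
  shows "card {\<sigma>\<in>cubes q n (Suc k). \<tau> \<subseteq> \<sigma>} = 2 * (q - k)"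
proof -
  obtain \<rho> x where \<tau>: "\<tau> = cube q n (\<rho>, x)" and \<rho>: "\<rho> \<in> simplices q (int k - 1)" and x: "x \<in> G"
    using assms by (auto simp: cubes_eq)
  have "card {\<sigma>\<in>cubes q n (Suc k). \<tau> \<subseteq> \<sigma>} = (\<Sum>\<sigma>\<in>cubes q n (Suc k). if \<tau> \<subseteq> \<sigma> then 1 else 0)"
    using finite_cubes by (simp add: sum.inter_filter[symmetric])
  also have "\<dots> = (\<Sum>t\<in>simplices q (int (Suc k) - 1) \<times> G. if inc (\<rho>, x) t then 1 else 0)"
    unfolding sum_cubes \<tau> using \<rho> x cube_subset_iff_inc[of "(\<rho>, x)" k]
    by (intro sum.cong refl) simp
  also have "\<dots> = (\<Sum>t | t \<in> simplices q (int (Suc k) - 1) \<times> G \<and> inc (\<rho>, x) t. 1)"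
    by (intro sum.inter_filter[symmetric]) simp
  also have "\<dots> = (\<Sum>i\<in>{1..q} - \<rho>. 1 + 1)"
    using \<rho> x by (rule sum_cofaces)
  also have "\<dots> = 2 * (q - k)"
    using \<rho> finite_subset[of \<rho> "{1..q}"] unfolding simplices_of_nat by (simp add: card_Diff_subset)
  finally show ?thesis .
qed

lemma card_flags: "card (flags q n (Suc k)) = 2 * (q - k) * card (cubes q n k)"
proof -
  have "flags q n (Suc k) = (SIGMA \<tau>:cubes q n k. {\<sigma>\<in>cubes q n (Suc k). \<tau> \<subseteq> \<sigma>})"
    by (auto simp: flags_def)
  thus ?thesis
    using finite_cubes by (simp add: card_SigmaI card_cofaces)
qed

text \<open>\<open>det_on_flags\<close> applied to cubes, followed by the passage to coordinates and
  the Fourier splitting. The exponents are counts of flags and cubes, each a binomial expression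
  times the torus size.\<close>

lemma det_on_flags_eq_prod:
  fixes u :: complex
  assumes d: "d = Suc k" "d \<le> q"
    and u: "1 - u \<noteq> 0" "1 + of_int (beta d) * u \<noteq> 0" "1 + of_int (alpha q d) * u \<noteq> 0"
  shows "det_on (flags q n d) (\<lambda>f f'. (if f = f' then 1 else 0) - u * of_bool (step f f')) =
    (1 - u) powi (kappa q d * torus_size q n) *
    (1 + of_int (beta d) * u) powi (gamma q d * torus_size q n) *
    (\<Prod>z\<in>Z. det_on (simplices q (int d - 2))
      (\<lambda>\<sigma> \<sigma>'. (1 + of_int (alpha q d) * u) * (1 + of_int (beta d) * u) * id_mat \<sigma> \<sigma>' - u * A_up q d z \<sigma> \<sigma>'))"
proof -
  define a b where "a = 2 * (q - k)" and "b = 2 * Suc k"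
  define V W where "V = cubes q n k" and "W = cubes q n (Suc k)"
  define c where "c = (1 + of_int (alpha q d) * u) * (1 + of_int (beta d) * u)"
  have c0: "c \<noteq> 0" using u by (simp add: c_def)
  have ab: "of_nat a - 1 = (of_int (alpha q d) :: complex)" "of_nat b - 1 = (of_int (beta d) :: complex)"
    using d by (simp_all add: a_def b_def alpha_def beta_def of_nat_diff)
  let ?N = "torus_size q n"
  have cV: "int (card V) = int (q choose k) * ?N" and cW: "int (card W) = int (q choose Suc k) * ?N"
    unfolding V_def W_def by (rule card_cubes)+
  \<comment> \<open>This absorption identity splits the flag count \<open>2 (q - k)\<close> times
    \<open>q choose k\<close> evenly between the two binomials, which is the symmetric form of
    \<open>kappa\<close>.\<close>
  have binom: "int (Suc k) * int (q choose Suc k) = (int q - int k) * int (q choose k)"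
  proof -
    have "Suc k * (q choose Suc k) = (q - k) * (q choose k)"
      using d binomial_absorption[of k q] binomial_absorb_comp[of q k] by simp
    hence "int (Suc k * (q choose Suc k)) = int ((q - k) * (q choose k))" by simp
    thus ?thesis using d by (simp add: of_nat_diff algebra_simps)
  qed
  have "2 * (int q - int k) * (int (q choose k) * ?N) - int (q choose k) * ?N - int (q choose Suc k) * ?N =
      kappa q d * ?N"
  proof -
    have "2 * (int q - int k) * int (q choose k) - int (q choose k) - int (q choose Suc k) = kappa q d"
      using binom by (simp add: kappa_def d algebra_simps)
    thus ?thesis by (metis (no_types, opaque_lifting) left_diff_distrib mult.assoc)
  qed
  hence e1: "int (card (flags q n d)) - int (card V) - int (card W) = kappa q d * ?N"
    using d by (simp add: card_flags V_def[symmetric] cV cW of_nat_diff)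
  have e2: "int (card W) - int (card V) = gamma q d * ?N"
    by (simp add: cV cW gamma_def d left_diff_distrib)
  have flags: "flags q n d = {(v, w). v \<in> V \<and> w \<in> W \<and> v \<subseteq> w}"
    by (simp add: flags_def V_def W_def d)
  have "det_on (flags q n d) (\<lambda>f f'. (if f = f' then 1 else 0) - u * of_bool (step f f')) =
      (1 - u) powi (kappa q d * ?N) * (1 + of_int (beta d) * u) powi (gamma q d * ?N) *
      det_on V (\<lambda>v v'. (if v = v' then c else 0) - u * (\<Sum>w\<in>W. of_bool (v \<subseteq> w) * of_bool (v' \<subseteq> w)))"
    unfolding step_def e1[symmetric] e2[symmetric] flags c_def ab[symmetric]
  proof (rule det_on_flags)
    show "finite V" "finite W" by (simp_all add: V_def W_def finite_cubes)
    show "card {w\<in>W. v \<subseteq> w} = a" if "v \<in> V" for v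
      using that unfolding V_def W_def a_def by (rule card_cofaces)
    show "card {v\<in>V. v \<subseteq> w} = b" if "w \<in> W" for w
      using that unfolding V_def W_def b_def by (rule card_faces)
    show "u \<noteq> 1" "1 + (of_nat b - 1) * u \<noteq> 0" using u by (auto simp: ab)
  qed
  also have "det_on V (\<lambda>v v'. (if v = v' then c else 0) - u * (\<Sum>w\<in>W. of_bool (v \<subseteq> w) * of_bool (v' \<subseteq> w))) =
      det_on (simplices q (int k - 1) \<times> G) (\<lambda>s s'. (if s = s' then c else 0) -
        u * (\<Sum>t\<in>simplices q (int (Suc k) - 1) \<times> G. of_bool (inc s t) * of_bool (inc s' t)))"
  proof -
    have "det_on V (\<lambda>v v'. (if v = v' then c else 0) - u * (\<Sum>w\<in>W. of_bool (v \<subseteq> w) * of_bool (v' \<subseteq> w))) =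
        det_on (simplices q (int k - 1) \<times> G) (\<lambda>s s'. (if cube q n s = cube q n s' then c else 0) -
          u * (\<Sum>w\<in>W. of_bool (cube q n s \<subseteq> w) * of_bool (cube q n s' \<subseteq> w)))"
      unfolding V_def by (rule det_on_reindex[OF bij_betw_cube]) simp
    also have "\<dots> = det_on (simplices q (int k - 1) \<times> G) (\<lambda>s s'. (if s = s' then c else 0) -
        u * (\<Sum>t\<in>simplices q (int (Suc k) - 1) \<times> G. of_bool (inc s t) * of_bool (inc s' t)))"
    proof (rule det_on_cong)
      fix s s' assume s: "s \<in> simplices q (int k - 1) \<times> G" "s' \<in> simplices q (int k - 1) \<times> G"
      have "cube q n s = cube q n s' \<longleftrightarrow> s = s'"
        using s inj_on_eq_iff[OF bij_betw_imp_inj_on[OF bij_betw_cube]] by blast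
      moreover have "(\<Sum>w\<in>W. of_bool (cube q n s \<subseteq> w) * of_bool (cube q n s' \<subseteq> w) :: complex) =
          (\<Sum>t\<in>simplices q (int (Suc k) - 1) \<times> G. of_bool (inc s t) * of_bool (inc s' t))"
        unfolding W_def sum_cubes
        by (intro sum.cong refl) (simp only: cube_subset_iff_inc[OF s(1)] cube_subset_iff_inc[OF s(2)])
      ultimately show "(if cube q n s = cube q n s' then c else 0) -
          u * (\<Sum>w\<in>W. of_bool (cube q n s \<subseteq> w) * of_bool (cube q n s' \<subseteq> w)) =
        (if s = s' then c else 0) -
          u * (\<Sum>t\<in>simplices q (int (Suc k) - 1) \<times> G. of_bool (inc s t) * of_bool (inc s' t))"
        by (simp only:)
    qed
    finally show ?thesis .
  qed
  also have "\<dots> = (\<Prod>z\<in>Z. det_on (simplices q (int k - 1)) (\<lambda>\<rho> \<rho>'. c * id_mat \<rho> \<rho>' - u * A_up q (Suc k) z \<rho> \<rho>'))"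
    using c0 by (rule det_on_grid_eq_prod)
  also have "int k - 1 = int d - 2" using d by simp
  finally show ?thesis by (simp only: d(1) c_def)
qed

text \<open>One factor \<open>c powi gamma q d\<close> per character gives the exponent
  \<open>gamma q d * torus_size q n\<close>. The \<open>alpha\<close> part of \<open>c\<close>
  cancels the negative power on the left, and the \<open>beta\<close> part is the prefactor on the
  right.\<close>

lemma prod_det_on_A_down:
  fixes u :: complex
  assumes d: "d = Suc k"
    and u: "1 + of_int (beta d) * u \<noteq> 0" "1 + of_int (alpha q d) * u \<noteq> 0"
  defines "c \<equiv> (1 + of_int (alpha q d) * u) * (1 + of_int (beta d) * u)"
  shows "(1 + of_int (alpha q d) * u) powi (- gamma q d * torus_size q n) *
      (\<Prod>z\<in>Z. det_on (simplices q (int d - 1)) (\<lambda>\<sigma> \<sigma>'. c * id_mat \<sigma> \<sigma>' - u * A_down q d z \<sigma> \<sigma>')) =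
    (1 + of_int (beta d) * u) powi (gamma q d * torus_size q n) *
      (\<Prod>z\<in>Z. det_on (simplices q (int d - 2)) (\<lambda>\<sigma> \<sigma>'. c * id_mat \<sigma> \<sigma>' - u * A_up q d z \<sigma> \<sigma>'))"
proof -
  have c0: "c \<noteq> 0" using u by (simp add: c_def)
  have g: "gamma q d = int (q choose Suc k) - int (q choose k)" by (simp add: gamma_def d)
  have d2: "int d - 2 = int k - 1" by (simp add: d)
  have "(\<Prod>z\<in>Z. det_on (simplices q (int d - 1)) (\<lambda>\<sigma> \<sigma>'. c * id_mat \<sigma> \<sigma>' - u * A_down q d z \<sigma> \<sigma>')) =
      (\<Prod>z\<in>Z. c powi gamma q d * det_on (simplices q (int d - 2)) (\<lambda>\<sigma> \<sigma>'. c * id_mat \<sigma> \<sigma>' - u * A_up q d z \<sigma> \<sigma>'))"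
    unfolding d2 g unfolding d by (intro prod.cong refl det_on_A_down c0)
  also have "\<dots> = c powi (gamma q d * torus_size q n) *
      (\<Prod>z\<in>Z. det_on (simplices q (int d - 2)) (\<lambda>\<sigma> \<sigma>'. c * id_mat \<sigma> \<sigma>' - u * A_up q d z \<sigma> \<sigma>'))"
    by (simp add: prod.distrib card_characters power_int_mult flip: card_grid)
  also have "c powi (gamma q d * torus_size q n) =
      (1 + of_int (alpha q d) * u) powi (gamma q d * torus_size q n) *
      (1 + of_int (beta d) * u) powi (gamma q d * torus_size q n)"
    unfolding c_def by (rule power_int_mult_distrib)
  finally show ?thesis using u by (simp add: power_int_minus)
qed

end

theorem theorem3p5:
  fixes q d :: nat and n :: "nat \<Rightarrow> nat"
  assumes side_lengths: "\<And>i. i \<in> {1..q} \<Longrightarrow> n i \<ge> 2"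
    and dim: "1 \<le> d" "d \<le> q"
  shows "\<forall>\<^sub>F u in nhds (0::complex).
    zeta_converges q n d u \<and>
    inverse (zeta q n d u) =
      (1 - u) powi (kappa q d * torus_size q n) *
      (1 + of_int (beta d) * u) powi (gamma q d * torus_size q n) *
      (\<Prod>z\<in>torus_characters q n. det_on (simplices q (int d - 2))
         (\<lambda>\<sigma> \<sigma>'. (1 + of_int (alpha q d) * u) * (1 + of_int (beta d) * u) * id_mat \<sigma> \<sigma>'
                  - u * A_up q d z \<sigma> \<sigma>')) \<and>
    inverse (zeta q n d u) =
      (1 - u) powi (kappa q d * torus_size q n) *
      (1 + of_int (alpha q d) * u) powi (- gamma q d * torus_size q n) *
      (\<Prod>z\<in>torus_characters q n. det_on (simplices q (int d - 1))
         (\<lambda>\<sigma> \<sigma>'. (1 + of_int (alpha q d) * u) * (1 + of_int (beta d) * u) * id_mat \<sigma> \<sigma>'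
                  - u * A_down q d z \<sigma> \<sigma>'))"
proof -
  interpret torus q n by unfold_locales (rule side_lengths)
  obtain k where k: "d = Suc k" using dim by (cases d) auto
  have "finite (flags q n d)"
    by (rule finite_subset[of _ "cubes q n (d - 1) \<times> cubes q n d"]) (auto simp: flags_def finite_cubes)
  note euler_product_prime_words[OF this, of step]
  moreover have "\<forall>\<^sub>F u in nhds 0. 1 + c * u \<noteq> 0" for c :: complex
    unfolding eventually_nhds
    by (rule exI[of _ "{u. 1 + c * u \<noteq> 0}"]) (auto intro!: open_Collect_neq continuous_intros)
  \<comment> \<open>These keep the bases \<open>1 - u\<close>, \<open>1 + \<beta> u\<close> and
    \<open>1 + \<alpha> u\<close> nonzero, as the factorisations and the integer powers of negative
    exponent require.\<close>
  note this[of "-1"] this[of "of_int (beta d)"] this[of "of_int (alpha q d)"]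
  ultimately show ?thesis
  proof eventually_elim
    case (elim u)
    let ?D = "det_on (flags q n d) (\<lambda>f f'. (if f = f' then 1 else 0) - u * of_bool (step f f'))"
    have lim: "(zeta_partial u \<longlongrightarrow> inverse ?D) (finite_subsets_at_top (prime_cycles q n d))"
      using elim(1) unfolding prime_cycles_eq zeta_partial_def[abs_def] cycle_length_def by blast
    \<comment> \<open>The limit is the inverse of a nonzero determinant, hence nonzero as the notion
      of convergence demands.\<close>
    hence conv: "zeta_converges q n d u"
      using elim(1) unfolding zeta_converges_def by (intro exI[of _ "inverse ?D"]) simp
    have "inverse (zeta q n d u) = ?D"
      using tendsto_Lim[OF _ lim] by (simp add: zeta_def)
    also note det_on_flags_eq_prod[OF k dim(2)]
    finally have "inverse (zeta q n d u) =
        (1 - u) powi (kappa q d * torus_size q n) *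
        (1 + of_int (beta d) * u) powi (gamma q d * torus_size q n) *
        (\<Prod>z\<in>Z. det_on (simplices q (int d - 2))
           (\<lambda>\<sigma> \<sigma>'. (1 + of_int (alpha q d) * u) * (1 + of_int (beta d) * u) * id_mat \<sigma> \<sigma>'
                    - u * A_up q d z \<sigma> \<sigma>'))"
      using elim(2-4) by simp
    with conv prod_det_on_A_down[OF k elim(3,4)] show ?case
      by (simp only: mult.assoc simp_thms)
  qed
qed

end
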